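(* Let $\{\mu_{nk}:n\in\mathbb{N},1\le k\le k_n\}\subset\mathcal{M}_{\mathbb{T}}^{\times}$ be an infinitesimal array, let $\{\lambda_n\}_{n=1}^\infty\subset\mathbb{T}$, and put $$\mu_n=\delta_{\lambda_n}\uplus_\times\mu_{n1}\uplus_\times\cdots\uplus_\times\mu_{nk_n},\qquad \nu_n=\delta_{\lambda_n}\circledast\mu_{n1}\circledast\cdots\circledast\mu_{nk_n},\qquad n\in\mathbb{N}.$$ Let $\gamma\in\mathbb{T}$ and let $\sigma$ be a finite positive Borel measure on $\mathbb{T}$. If the sequence $\mu_n$ converges weakly to $\nu_{\uplus_\times}^{\gamma,\sigma}$, then there exists a probability measure $\nu$ on $\mathbb{T}$ such that the sequence $\nu_n$ converges weakly to $\nu$. Moreover, the Fourier coefficients of $\nu$ are given by $$\widehat{\nu}(p)=\gamma^p\exp\left(\int_{\mathbb{T}}\frac{\zeta^p-1-ip\Im\zeta}{1-\Re\zeta}\,d\sigma(\zeta)\right),\qquad p\in\mathbb{Z}.$$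
   Context: $\mathbb{T}$ is the unit circle, $\mathbb{D}$ the open unit disk; $\mathcal{M}_{\mathbb{T}}^{\times}$ is the set of Borel probability measures $\mu$ on $\mathbb{T}$ with $\int_{\mathbb{T}}\zeta\,d\mu(\zeta)\ne0$; $\delta_\lambda$ is the point mass at $\lambda$. $\{k_n\}$ is a sequence of natural numbers. An array $\{\mu_{nk}\}_{n\in\mathbb{N},1\le k\le k_n}$ of probability measures on $\mathbb{T}$ is infinitesimal if $\lim_{n\to\infty}\max_{1\le k\le k_n}\mu_{nk}(\{\zeta\in\mathbb{T}:|\zeta-1|\ge\varepsilon\})=0$ for every $\varepsilon>0$. For a probability measure $\mu$ on $\mathbb{T}$ put $\psi_\mu(z)=\int_{\mathbb{T}}\frac{\zeta z}{1-\zeta z}\,d\mu(\zeta)$ and $B_\mu(z)=\frac1z\frac{\psi_\mu(z)}{1+\psi_\mu(z)}$, $z\in\mathbb{D}$ (with the singularity at $0$ removed). The map $\mu\mapsto B_\mu$ is a bijection from probability measures on $\mathbb{T}$ to analytic functions $\mathbb{D}\to\overline{\mathbb{D}}$. The multiplicative boolean convolution $\mu_1\uplus_\times\mu_2$ is the probability measure determined by $B_{\mu_1\uplus_\times\mu_2}(z)=B_{\mu_1}(z)B_{\mu_2}(z)$, $z\in\mathbb{D}$. $\nu_{\uplus_\times}^{\gamma,\sigma}$ is the probability measure on $\mathbb{T}$ with $B_\nu(z)=\gamma\exp\left(-\int_{\mathbb{T}}\frac{1+\zeta z}{1-\zeta z}\,d\sigma(\zeta)\right)$, $z\in\mathbb{D}$.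 $\circledast$ is the classical convolution of probability measures on the group $\mathbb{T}$ (law of a product of independent $\mathbb{T}$-valued random variables). Fourier coefficients are $\widehat{\nu}(p)=\int_{\mathbb{T}}\zeta^p\,d\nu(\zeta)$. The function $\zeta\mapsto\frac{\zeta^p-1-ip\Im\zeta}{1-\Re\zeta}$ is given the value $-p^2$ at $\zeta=1$, which makes it continuous and bounded on $\mathbb{T}$. *)

theory Defs
  imports "HOL-Probability.Probability" "HOL-Complex_Analysis.Complex_Analysis"
begin

definition circle_borel :: "complex measure" where
  "circle_borel = restrict_space borel (sphere 0 1)"

definition circle_prob :: "complex measure set" where
  "circle_prob = {\<mu>. prob_space \<mu> \<and> sets \<mu> = sets circle_borel}"

definition circle_prob_nz :: "complex measure set" where
  "circle_prob_nz = {\<mu> \<in> circle_prob. (\<integral>\<zeta>. \<zeta> \<partial>\<mu>) \<noteq> 0}"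

definition circle_weak_conv :: "(nat \<Rightarrow> complex measure) \<Rightarrow> complex measure \<Rightarrow> bool" where
  "circle_weak_conv M \<mu> \<longleftrightarrow>
     (\<forall>f :: complex \<Rightarrow> real. continuous_on (sphere 0 1) f \<longrightarrow>
        (\<lambda>n. \<integral>\<zeta>. f \<zeta> \<partial>(M n)) \<longlonglongrightarrow> (\<integral>\<zeta>. f \<zeta> \<partial>\<mu>))"

text \<open>Only rows \<open>n \<ge> 1\<close> and entries \<open>1 \<le> i \<le> k n\<close> of an array \<open>\<mu> n i\<close> are meaningful.\<close>

definition infinitesimal_array :: "(nat \<Rightarrow> nat) \<Rightarrow> (nat \<Rightarrow> nat \<Rightarrow> complex measure) \<Rightarrow> bool" where
  "infinitesimal_array k \<mu> \<longleftrightarrow>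
     (\<forall>\<epsilon>>0. (\<lambda>n. MAX i\<in>{1..k n}. measure (\<mu> n i) {\<zeta> \<in> sphere 0 1. cmod (\<zeta> - 1) \<ge> \<epsilon>})
        \<longlonglongrightarrow> 0)"

definition psi_transform :: "complex measure \<Rightarrow> complex \<Rightarrow> complex" where
  "psi_transform \<mu> z = (\<integral>\<zeta>. \<zeta> * z / (1 - \<zeta> * z) \<partial>\<mu>)"

text \<open>On the open unit disk the only singularity is the removable one at \<open>0\<close>.\<close>

definition B_transform :: "complex measure \<Rightarrow> complex \<Rightarrow> complex" where
  "B_transform \<mu> =
     remove_sings (\<lambda>z. 1 / z * (psi_transform \<mu> z / (1 + psi_transform \<mu> z)))"

text \<open>The descriptions below are proper because \<open>\<mu> \<mapsto> B_transform \<mu>\<close> is a bijection from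
  \<open>circle_prob\<close> onto the analytic functions from the open to the closed unit disk.\<close>

definition bool_mult_conv :: "complex measure \<Rightarrow> complex measure \<Rightarrow> complex measure" where
  "bool_mult_conv \<mu>1 \<mu>2 =
     (THE \<mu>. \<mu> \<in> circle_prob \<and>
        (\<forall>z\<in>ball 0 1. B_transform \<mu> z = B_transform \<mu>1 z * B_transform \<mu>2 z))"

definition bool_infdiv :: "complex \<Rightarrow> complex measure \<Rightarrow> complex measure" where
  "bool_infdiv \<gamma> \<sigma> =
     (THE \<nu>. \<nu> \<in> circle_prob \<and>
        (\<forall>z\<in>ball 0 1. B_transform \<nu> z =
           \<gamma> * exp (- (\<integral>\<zeta>. (1 + \<zeta> * z) / (1 - \<zeta> * z) \<partial>\<sigma>))))"

definition circle_conv :: "complex measure \<Rightarrow> complex measure \<Rightarrow> complex measure" where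
  "circle_conv \<mu>1 \<mu>2 = distr (\<mu>1 \<Otimes>\<^sub>M \<mu>2) circle_borel (\<lambda>(x, y). x * y)"

definition conv_row ::
  "(complex measure \<Rightarrow> complex measure \<Rightarrow> complex measure) \<Rightarrow>
    complex \<Rightarrow> (nat \<Rightarrow> complex measure) \<Rightarrow> nat \<Rightarrow> complex measure" where
  "conv_row conv c M m = foldl conv (return circle_borel c) (map M [1..<Suc m])"

definition fourier_coeff :: "complex measure \<Rightarrow> int \<Rightarrow> complex" where
  "fourier_coeff \<nu> p = (\<integral>\<zeta>. \<zeta> powi p \<partial>\<nu>)"

text \<open>The value at \<open>\<zeta> = 1\<close> is the continuous extension along the unit circle.\<close>

definition levy_kernel :: "int \<Rightarrow> complex \<Rightarrow> complex" where
  "levy_kernel p \<zeta> =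
     (if \<zeta> = 1 then - (of_int p)\<^sup>2
      else (\<zeta> powi p - 1 - \<i> * of_int p * of_real (Im \<zeta>)) / of_real (1 - Re \<zeta>))"

end

theory Submission
  imports Defs
begin

text \<open>
  Both convolutions turn into products: the boolean one into products of \<open>B\<close>-transforms, the classical
  one into products of moments. For an infinitesimal array both products are, up to a vanishing error,
  exponentials of integrals against one and the same measure.

  To see this, rotate each entry \<open>\<mu>\<close> of the array so that its mean becomes positive, and let
  \<open>d = 1 - |m|\<close>, where \<open>m\<close> is the mean of \<open>\<mu>\<close>. The rotated measure \<open>\<mu>'\<close> has \<open>\<integral> Im \<zeta> d\<mu>' = 0\<close>, and
  the measure \<open>\<tau> = (1 - Re \<zeta>) d\<mu>'\<close> has total mass \<open>d\<close>. Because the linear term has been removed, the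
  moments and the \<open>B\<close>-transform of \<open>\<mu>'\<close> are governed by \<open>\<tau>\<close>: the \<open>p\<close>-th moment is exactly
  \<open>1 + \<integral> L\<^sub>p d\<tau>\<close> with the Levy kernel \<open>L\<^sub>p\<close> (\<open>centred_moment\<close>), and
  \<open>B(z) = 1 - \<integral> (1 + \<zeta>z)/(1 - \<zeta>z) d\<tau> + O(d\<^sup>2)\<close> (\<open>centred_B_transform_approx\<close>).

  Let \<open>\<tau>\<^sub>n\<close> be the sum of the measures \<open>\<tau>\<close> over row \<open>n\<close>, and \<open>\<gamma>\<^sub>n\<close> the product of \<open>\<lambda>\<^sub>n\<close> with the
  rotations undone. The hypothesis says that the \<open>B\<close>-transforms converge on the disk. At \<open>z = 0\<close> this gives
  \<open>\<tau>\<^sub>n(\<T>) \<rightarrow> \<sigma>(\<T>)\<close> and \<open>\<gamma>\<^sub>n \<rightarrow> \<gamma>\<close>. For small \<open>z \<noteq> 0\<close> it gives convergence of the exponentials of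
  \<open>- \<integral> (1 + \<zeta>z)/(1 - \<zeta>z) d\<tau>\<^sub>n\<close>. Near \<open>0\<close> the logarithm is unambiguous, so the power series
  themselves converge, and hence so does each of their coefficients, and these determine the moments of \<open>\<tau>\<^sub>n\<close>
  (\<open>sum_moment_tilt_tendsto\<close>). Since \<open>L\<^sub>p\<close> is a trigonometric polynomial whose integral is a
  combination of moments, \<open>\<integral> L\<^sub>p d\<tau>\<^sub>n \<rightarrow> \<integral> L\<^sub>p d\<sigma>\<close>, and the moments of the classical convolutions
  converge to \<open>\<gamma>\<^sup>p exp (\<integral> L\<^sub>p d\<sigma>)\<close>. By weak compactness of the probability measures on the circle
  the limits are the moments of a measure, to which the convolutions converge weakly
  (\<open>circle_prob_moment_limit\<close>).

  That the boolean convolution and \<open>bool_infdiv\<close> are the intended measures rests on the bijectivity of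
  the \<open>B\<close>-transform. Injectivity is the uniqueness of a measure with given moments;
  surjectivity is the Herglotz representation of functions with nonnegative real part
  (\<open>herglotz_representation\<close>).
\<close>

section \<open>Finite measures on the circle\<close>

definition circle_measure :: "complex measure \<Rightarrow> bool" where
  "circle_measure M \<longleftrightarrow> finite_measure M \<and> sets M = sets circle_borel"

lemma circle_prob_imp_circle_measure: "M \<in> circle_prob \<Longrightarrow> circle_measure M"
  by (auto simp: circle_prob_def circle_measure_def prob_space.finite_measure)

lemma circle_measureD:
  assumes "circle_measure M"
  shows "finite_measure M" "sets M = sets circle_borel" "space M = sphere 0 1"
proof -
  show *: "finite_measure M" "sets M = sets circle_borel"
    using assms by (auto simp: circle_measure_def)
  show "space M = sphere 0 1"
    using sets_eq_imp_space_eq[OF *(2)] by (simp add: circle_borel_def space_restrict_space)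
qed

lemma circle_measurable_continuous:
  assumes "sets M = sets circle_borel" "continuous_on (sphere 0 1) f"
  shows "f \<in> borel_measurable M"
  using borel_measurable_continuous_on_restrict[OF assms(2)] assms(1)
  by (simp add: circle_borel_def cong: measurable_cong_sets)

lemma circle_integrable:
  fixes f :: "complex \<Rightarrow> 'b :: {banach, second_countable_topology}"
  assumes M: "circle_measure M" and f: "continuous_on (sphere 0 1) f"
  shows "integrable M f"
proof -
  interpret finite_measure M using circle_measureD(1)[OF M] .
  have "compact (f ` sphere 0 1)"
    using f by (intro compact_continuous_image) auto
  then obtain B where B: "\<And>x. x \<in> sphere 0 1 \<Longrightarrow> norm (f x) \<le> B"
    by (metis bounded_iff compact_imp_bounded imageI)
  show ?thesis
    by (rule integrable_const_bound[where B = B])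
       (use B circle_measureD[OF M] circle_measurable_continuous f in auto)
qed

lemma circle_norm_integral_le:
  fixes f :: "complex \<Rightarrow> 'b :: {banach, second_countable_topology}"
  assumes M: "circle_measure M" and f: "\<And>x. norm x = 1 \<Longrightarrow> norm (f x) \<le> C"
  shows "norm (\<integral>x. f x \<partial>M) \<le> C * measure M (space M)"
proof (cases "integrable M f")
  case True
  interpret finite_measure M using circle_measureD(1)[OF M] .
  have "norm (\<integral>x. f x \<partial>M) \<le> (\<integral>x. norm (f x) \<partial>M)"
    by simp
  also have "\<dots> \<le> (\<integral>x. C \<partial>M)"
    by (intro integral_mono_AE AE_I2 integrable_norm True)
       (use f circle_measureD(3)[OF M] in auto)
  finally show ?thesis by (simp add: mult.commute)
next
  case False
  have "norm (f 1) \<le> C" by (rule f) simp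
  then have "0 \<le> C" using norm_ge_zero order_trans by blast
  then show ?thesis using False by (simp add: not_integrable_integral_eq)
qed

lemma circle_integral_cong:
  assumes "circle_measure M" "\<And>x. norm x = 1 \<Longrightarrow> f x = g x"
  shows "(\<integral>x. f x \<partial>M) = (\<integral>x. g x \<partial>M)"
  by (intro Bochner_Integration.integral_cong refl) (use assms circle_measureD(3) in auto)

lemma circle_prob_measure_space: "M \<in> circle_prob \<Longrightarrow> measure M (space M) = 1"
  by (auto simp: circle_prob_def prob_space.prob_space)

lemma one_minus_mult_nonzero:
  fixes z \<zeta> :: complex
  assumes "norm \<zeta> = 1" "norm z < 1" shows "1 - \<zeta> * z \<noteq> 0"
proof
  assume "1 - \<zeta> * z = 0"
  then have "norm (\<zeta> * z) = 1" by (metis eq_iff_diff_eq_0 norm_one)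
  then show False using assms by (simp add: norm_mult)
qed

lemma one_minus_norm_le:
  fixes z \<zeta> :: complex
  assumes "norm \<zeta> = 1" shows "1 - norm z \<le> norm (1 - \<zeta> * z)"
  using norm_triangle_ineq2[of 1 "\<zeta> * z"] assms by (simp add: norm_mult)

section \<open>Moments and the Cauchy transform\<close>

definition moment :: "complex measure \<Rightarrow> nat \<Rightarrow> complex" where
  "moment M j = (\<integral>\<zeta>. \<zeta> ^ j \<partial>M)"

definition cauchy_transform :: "complex measure \<Rightarrow> complex \<Rightarrow> complex" where
  "cauchy_transform M z = (\<integral>\<zeta>. 1 / (1 - \<zeta> * z) \<partial>M)"

lemma moment_0: "circle_measure M \<Longrightarrow> moment M 0 = of_real (measure M (space M))"
  by (simp add: moment_def scaleR_conv_of_real)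

lemma norm_moment_le: "circle_measure M \<Longrightarrow> norm (moment M j) \<le> measure M (space M)"
  unfolding moment_def using circle_norm_integral_le[of M "\<lambda>x. x^j" 1] by (simp add: norm_power)

lemma cauchy_transform_sums:
  assumes M: "circle_measure M" and z: "norm z < 1"
  shows "(\<lambda>j. moment M j * z ^ j) sums cauchy_transform M z"
proof -
  have int: "integrable M (\<lambda>\<zeta>. (\<zeta> * z) ^ j)" for j
    by (intro circle_integrable M continuous_intros)
  have sm: "(\<lambda>j. norm ((\<zeta> * z) ^ j)) = (\<lambda>j. norm z ^ j)" if "norm \<zeta> = 1" for \<zeta>
    using that by (simp add: norm_power norm_mult fun_eq_iff)
  have gs: "summable (\<lambda>j. norm z ^ j)" using z by (simp add: summable_geometric)
  have "(\<lambda>j. \<integral>\<zeta>. (\<zeta> * z) ^ j \<partial>M) sums (\<integral>\<zeta>. (\<Sum>j. (\<zeta> * z) ^ j) \<partial>M)"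
  proof (rule sums_integral[OF int])
    show "AE \<zeta> in M. summable (\<lambda>j. norm ((\<zeta> * z) ^ j))"
      by (intro AE_I2) (simp add: circle_measureD(3)[OF M] sm z)
    have "(\<integral>\<zeta>. norm ((\<zeta> * z) ^ j) \<partial>M) = norm z ^ j * measure M (space M)" for j
    proof -
      have "(\<integral>\<zeta>. norm ((\<zeta> * z) ^ j) \<partial>M) = (\<integral>\<zeta>. norm z ^ j \<partial>M)"
        by (rule circle_integral_cong[OF M]) (simp add: norm_power norm_mult)
      then show ?thesis by simp
    qed
    then show "summable (\<lambda>j. \<integral>\<zeta>. norm ((\<zeta> * z) ^ j) \<partial>M)"
      using summable_mult2[OF gs] by simp
  qed
  moreover have "(\<integral>\<zeta>. (\<Sum>j. (\<zeta> * z) ^ j) \<partial>M) = cauchy_transform M z"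
    unfolding cauchy_transform_def
    by (intro circle_integral_cong[OF M] suminf_geometric) (use z in \<open>simp add: norm_mult\<close>)
  moreover have "(\<integral>\<zeta>. (\<zeta> * z) ^ j \<partial>M) = moment M j * z ^ j" for j
    unfolding moment_def power_mult_distrib by simp
  ultimately show ?thesis by simp
qed

lemma cauchy_transform_holomorphic:
  assumes M: "circle_measure M"
  shows "cauchy_transform M holomorphic_on ball 0 1"
  by (rule power_series_holomorphic[where a = "moment M"])
     (use cauchy_transform_sums[OF M] in \<open>auto simp: dist_norm\<close>)

text \<open>The half plane \<open>Re > 1/2\<close> is the image of the disk under \<open>w \<mapsto> 1 / (1 - w)\<close>. The explicit margin,
  which depends only on the modulus of \<open>w\<close>, survives integration and gives a strict inequality for
  the Cauchy transform.\<close>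

lemma Re_inverse_one_minus:
  assumes "norm w < 1"
  shows "Re (1 / (1 - w)) \<ge> 1 / 2 + (1 - (norm w)\<^sup>2) / 8"
proof -
  define q where "q = (norm (1 - w))\<^sup>2"
  have "w \<noteq> 1" using assms by auto
  then have q: "q > 0" by (simp add: q_def)
  have "norm (1 - w) \<le> 2" using norm_triangle_ineq4[of 1 w] assms by simp
  then have "q \<le> 2\<^sup>2" unfolding q_def by (intro power_mono) auto
  then have q4: "q \<le> 4" by simp
  have qe: "q = 1 - 2 * Re w + (norm w)\<^sup>2"
    unfolding q_def cmod_power2 by (simp add: power2_eq_square algebra_simps)
  have "0 \<le> 1 - (norm w)\<^sup>2" using assms by (simp add: abs_square_le_1)
  then have "(1 - (norm w)\<^sup>2) / 8 \<le> (1 - (norm w)\<^sup>2) / (2 * q)"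
    using q q4 by (intro divide_left_mono) auto
  also have "\<dots> = (1 - Re w) / q - 1 / 2" using q by (simp add: qe field_simps)
  also have "(1 - Re w) / q = Re (1 / (1 - w))"
    by (simp add: Re_divide cmod_power2 q_def)
  finally show ?thesis by linarith
qed

lemma Re_cauchy_transform:
  assumes M: "M \<in> circle_prob" and z: "norm z < 1"
  shows "Re (cauchy_transform M z) > 1 / 2"
proof -
  note M' = circle_prob_imp_circle_measure[OF M]
  have int: "integrable M (\<lambda>\<zeta>. 1 / (1 - \<zeta> * z))"
    by (intro circle_integrable M' continuous_intros) (use one_minus_mult_nonzero z in auto)
  have "0 < (1 - (norm z)\<^sup>2) / 8" using z by (simp add: abs_square_less_1)
  then have "1 / 2 < 1 / 2 + (1 - (norm z)\<^sup>2) / 8" by simp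
  also have "\<dots> = (\<integral>\<zeta>. 1 / 2 + (1 - (norm z)\<^sup>2) / 8 \<partial>M)"
    using M by (simp add: circle_prob_measure_space)
  also have "\<dots> \<le> (\<integral>\<zeta>. Re (1 / (1 - \<zeta> * z)) \<partial>M)"
  proof (intro integral_mono_AE AE_I2)
    show "integrable M (\<lambda>\<zeta>. 1 / 2 + (1 - (norm z)\<^sup>2) / 8 :: real)"
      by (intro circle_integrable M' continuous_on_const)
    show "integrable M (\<lambda>\<zeta>. Re (1 / (1 - \<zeta> * z)))" using int by (rule integrable_Re)
    show "1 / 2 + (1 - (norm z)\<^sup>2) / 8 \<le> Re (1 / (1 - \<zeta> * z))" if "\<zeta> \<in> space M" for \<zeta>
      using Re_inverse_one_minus[of "\<zeta> * z"] that z circle_measureD(3)[OF M']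
      by (simp add: norm_mult)
  qed
  also have "\<dots> = Re (cauchy_transform M z)"
    unfolding cauchy_transform_def using int by simp
  finally show ?thesis .
qed

section \<open>Fourier coefficients and weak convergence\<close>

lemma fourier_coeff_of_nat: "fourier_coeff M (int j) = moment M j"
  by (simp add: fourier_coeff_def moment_def)

lemma powi_minus_circle:
  fixes \<zeta> :: complex
  assumes "norm \<zeta> = 1" shows "\<zeta> powi (- p) = cnj (\<zeta> powi p)"
proof -
  have "norm (\<zeta> powi p) = 1" using assms by (simp add: norm_power_int)
  then have "\<zeta> powi p * cnj (\<zeta> powi p) = 1"
    by (metis complex_norm_square of_real_1 one_power2)
  then show ?thesis
    by (metis power_int_minus inverse_unique)
qed

lemma fourier_coeff_minus:
  assumes "circle_measure M"
  shows "fourier_coeff M (- p) = cnj (fourier_coeff M p)"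
  unfolding fourier_coeff_def by (subst Bochner_Integration.integral_cnj[symmetric], rule circle_integral_cong[OF assms]) (simp add: powi_minus_circle)

text \<open>Only the values on the unit circle are prescribed, so that \<open>cnj \<zeta>\<close> may be
  replaced by \<open>\<zeta> powi (-1)\<close>.\<close>

inductive trig_polynomial :: "(complex \<Rightarrow> complex) \<Rightarrow> bool" where
  monom: "(\<And>\<zeta>. norm \<zeta> = 1 \<Longrightarrow> f \<zeta> = c * \<zeta> powi p) \<Longrightarrow> trig_polynomial f"
| add: "trig_polynomial f \<Longrightarrow> trig_polynomial g \<Longrightarrow>
          (\<And>\<zeta>. norm \<zeta> = 1 \<Longrightarrow> h \<zeta> = f \<zeta> + g \<zeta>) \<Longrightarrow> trig_polynomial h"

lemma trig_polynomial_monom_mult: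
  assumes "trig_polynomial g" "\<And>\<zeta>. norm \<zeta> = 1 \<Longrightarrow> h \<zeta> = c * \<zeta> powi p * g \<zeta>"
  shows "trig_polynomial h"
  using assms
proof (induction arbitrary: h rule: trig_polynomial.induct)
  case (monom f d q)
  show ?case
  proof (rule trig_polynomial.monom)
    fix \<zeta> :: complex assume "norm \<zeta> = 1"
    then have "\<zeta> \<noteq> 0" by auto
    then show "h \<zeta> = (c * d) * \<zeta> powi (p + q)"
      using monom \<open>norm \<zeta> = 1\<close> by (simp add: power_int_add)
  qed
next
  case (add f g f')
  show ?case
    by (rule trig_polynomial.add[where f = "\<lambda>\<zeta>. c * \<zeta> powi p * f \<zeta>" and g = "\<lambda>\<zeta>. c * \<zeta> powi p * g \<zeta>"])
       (use add in \<open>auto simp: algebra_simps\<close>)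
qed

lemma trig_polynomial_mult:
  assumes "trig_polynomial f" "trig_polynomial g" "\<And>\<zeta>. norm \<zeta> = 1 \<Longrightarrow> h \<zeta> = f \<zeta> * g \<zeta>"
  shows "trig_polynomial h"
  using assms
proof (induction arbitrary: h rule: trig_polynomial.induct)
  case (monom f d q)
  then show ?case by (intro trig_polynomial_monom_mult[OF monom(2), where c = d and p = q]) auto
next
  case (add f1 f2 f)
  show ?case
    by (rule trig_polynomial.add[where f = "\<lambda>\<zeta>. f1 \<zeta> * g \<zeta>" and g = "\<lambda>\<zeta>. f2 \<zeta> * g \<zeta>"])
       (use add in \<open>auto simp: algebra_simps\<close>)
qed

text \<open>On the circle \<open>Re \<zeta>\<close> and \<open>Im \<zeta>\<close> are combinations of \<open>\<zeta>\<close> and \<open>1/\<zeta>\<close>, and trigonometric polynomials are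
  closed under products. This makes the Stone-Weierstrass theorem for polynomials in the real
  coordinates of the plane available on the circle.\<close>

lemma real_polynomial_imp_trig_polynomial:
  fixes g :: "complex \<Rightarrow> real"
  assumes "real_polynomial_function g"
  shows "trig_polynomial (\<lambda>\<zeta>. of_real (g \<zeta>))"
  using assms
proof induction
  case (linear f)
  interpret bounded_linear f by fact
  \<comment> \<open>\<open>f\<close> is determined by its values at \<open>1\<close> and \<open>\<i>\<close>; expand in \<open>\<zeta>\<close> and \<open>1/\<zeta>\<close>\<close>
  define a where "a = (of_real (f 1) - \<i> * of_real (f \<i>)) / 2"
  show ?case
  proof (rule trig_polynomial.add[where f = "\<lambda>\<zeta>. a * \<zeta> powi 1" and g = "\<lambda>\<zeta>. cnj a * \<zeta> powi (-1)"])
    fix \<zeta> :: complex assume z: "norm \<zeta> = 1"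
    have "\<zeta> = Re \<zeta> *\<^sub>R 1 + Im \<zeta> *\<^sub>R \<i>" by (simp add: complex_eq_iff)
    then have "f \<zeta> = Re \<zeta> * f 1 + Im \<zeta> * f \<i>"
      by (metis add scale real_scaleR_def)
    then have "of_real (f \<zeta>) = a * \<zeta> + cnj a * cnj \<zeta>"
      by (simp add: a_def complex_eq_iff field_simps)
    also have "cnj \<zeta> = \<zeta> powi (-1)" using powi_minus_circle[OF z, of 1] by simp
    finally show "of_real (f \<zeta>) = a * \<zeta> powi 1 + cnj a * \<zeta> powi (-1)" by simp
  next
    show "trig_polynomial (\<lambda>\<zeta>. a * \<zeta> powi 1)" "trig_polynomial (\<lambda>\<zeta>. cnj a * \<zeta> powi (-1))"
      by (rule trig_polynomial.monom[OF refl])+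
  qed
next
  case (const c)
  show ?case by (rule trig_polynomial.monom[where c = "of_real c" and p = 0]) simp
next
  case (add f g)
  show ?case by (rule trig_polynomial.add[OF add.IH]) simp
next
  case (mult f g)
  show ?case by (rule trig_polynomial_mult[OF mult.IH]) simp
qed

text \<open>Integrability is part of the induction because the integral of a sum splits only for
  integrable summands.\<close>

lemma trig_polynomial_integral_tendsto:
  assumes "trig_polynomial g"
    and M: "\<And>n. circle_measure (M n)" and N: "circle_measure N"
    and lim: "\<And>p. (\<lambda>n. fourier_coeff (M n) p) \<longlonglongrightarrow> fourier_coeff N p"
  shows "(\<forall>L. circle_measure L \<longrightarrow> integrable L g) \<and>
    (\<lambda>n. \<integral>\<zeta>. g \<zeta> \<partial>M n) \<longlonglongrightarrow> (\<integral>\<zeta>. g \<zeta> \<partial>N)"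
  using assms(1)
proof induction
  case (monom f c p)
  have e: "(\<integral>\<zeta>. f \<zeta> \<partial>L) = c * fourier_coeff L p" if "circle_measure L" for L
    using circle_integral_cong[OF that monom] by (simp add: fourier_coeff_def)
  have "continuous_on (sphere 0 1) (\<lambda>\<zeta>. c * \<zeta> powi p)"
    by (intro continuous_intros) auto
  then have "continuous_on (sphere 0 1) f"
    using monom by (subst continuous_on_cong[OF refl, where g = "\<lambda>\<zeta>. c * \<zeta> powi p"]) auto
  then show ?case using lim[of p]
    by (auto simp: e M N intro!: tendsto_intros circle_integrable)
next
  case (add f g h)
  have i: "integrable L f" "integrable L g" if "circle_measure L" for L
    using add.IH that by auto
  have e: "integrable L h \<and> (\<integral>\<zeta>. h \<zeta> \<partial>L) = (\<integral>\<zeta>. f \<zeta> \<partial>L) + (\<integral>\<zeta>. g \<zeta> \<partial>L)" if L: "circle_measure L" for L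
  proof
    have "integrable L (\<lambda>\<zeta>. f \<zeta> + g \<zeta>)" using i[OF L] by simp
    then show "integrable L h"
      by (subst Bochner_Integration.integrable_cong[OF refl, where g = "\<lambda>\<zeta>. f \<zeta> + g \<zeta>"])
         (use circle_measureD(3)[OF L] add.hyps in auto)
    show "(\<integral>\<zeta>. h \<zeta> \<partial>L) = (\<integral>\<zeta>. f \<zeta> \<partial>L) + (\<integral>\<zeta>. g \<zeta> \<partial>L)"
      using circle_integral_cong[OF L add.hyps(3)] i[OF L] by simp
  qed
  show ?case using add.IH by (auto simp: e M N intro!: tendsto_intros)
qed

text \<open>Trigonometric polynomials are uniformly dense in the continuous functions on the circle, and
  the total masses are all \<open>1\<close>. Coefficients of negative index are conjugates of those of positive
  index, so the moments are enough.\<close>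

lemma fourier_coeff_tendsto_imp_weak_conv:
  assumes M: "\<And>n. M n \<in> circle_prob" and N: "N \<in> circle_prob"
    and lim: "\<And>j. (\<lambda>n. moment (M n) j) \<longlonglongrightarrow> moment N j"
  shows "circle_weak_conv M N"
  unfolding circle_weak_conv_def
proof (intro allI impI)
  fix f :: "complex \<Rightarrow> real" assume f: "continuous_on (sphere 0 1) f"
  note M' = circle_prob_imp_circle_measure[OF M] and N' = circle_prob_imp_circle_measure[OF N]
  have limp: "(\<lambda>n. fourier_coeff (M n) p) \<longlonglongrightarrow> fourier_coeff N p" for p
  proof (cases "p \<ge> 0")
    case True
    then show ?thesis using lim[of "nat p"] by (simp flip: fourier_coeff_of_nat)
  next
    case False
    then obtain j where p: "p = - int j" by (metis int_cases2 of_nat_0_le_iff)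
    show ?thesis unfolding p fourier_coeff_minus[OF M'] fourier_coeff_minus[OF N'] fourier_coeff_of_nat
      by (intro tendsto_intros lim)
  qed
  show "(\<lambda>n. \<integral>\<zeta>. f \<zeta> \<partial>M n) \<longlonglongrightarrow> (\<integral>\<zeta>. f \<zeta> \<partial>N)"
  proof (rule LIMSEQ_I)
    fix e :: real assume e: "e > 0"
    obtain g where g: "real_polynomial_function g" "\<And>x. x \<in> sphere 0 1 \<Longrightarrow> \<bar>f x - g x\<bar> < e / 3"
      using Stone_Weierstrass_real_polynomial_function[OF compact_sphere f, of "e / 3"] e by auto
    note T = trig_polynomial_integral_tendsto[OF real_polynomial_imp_trig_polynomial[OF g(1)] M' N' limp]
    have gi: "integrable L g" if "circle_measure L" for L
      using conjunct1[OF T, rule_format, OF that] by (simp only: complex_of_real_integrable_eq)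
    have "(\<lambda>n. complex_of_real (\<integral>\<zeta>. g \<zeta> \<partial>M n)) \<longlonglongrightarrow> complex_of_real (\<integral>\<zeta>. g \<zeta> \<partial>N)"
      using conjunct2[OF T] by (simp only: integral_complex_of_real)
    then have "(\<lambda>n. \<integral>\<zeta>. g \<zeta> \<partial>M n) \<longlonglongrightarrow> (\<integral>\<zeta>. g \<zeta> \<partial>N)"
      by (simp only: tendsto_of_real_iff)
    from LIMSEQ_D[OF this, of "e / 3"] e
    obtain n0 where n0: "\<And>n. n \<ge> n0 \<Longrightarrow> \<bar>(\<integral>\<zeta>. g \<zeta> \<partial>M n) - (\<integral>\<zeta>. g \<zeta> \<partial>N)\<bar> < e / 3"
      by auto
    have fg: "\<bar>(\<integral>\<zeta>. f \<zeta> \<partial>L) - (\<integral>\<zeta>. g \<zeta> \<partial>L)\<bar> \<le> e / 3" if L: "L \<in> circle_prob" for L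
    proof -
      note L' = circle_prob_imp_circle_measure[OF L]
      have "(\<integral>\<zeta>. f \<zeta> \<partial>L) - (\<integral>\<zeta>. g \<zeta> \<partial>L) = (\<integral>\<zeta>. f \<zeta> - g \<zeta> \<partial>L)"
        using circle_integrable[OF L' f] gi[OF L'] by simp
      also have "norm \<dots> \<le> e / 3 * measure L (space L)"
        using g(2) by (intro circle_norm_integral_le[OF L']) (simp add: less_imp_le)
      finally show ?thesis by (simp add: circle_prob_measure_space[OF L])
    qed
    show "\<exists>n0. \<forall>n\<ge>n0. norm ((\<integral>\<zeta>. f \<zeta> \<partial>M n) - (\<integral>\<zeta>. f \<zeta> \<partial>N)) < e"
    proof (intro exI allI impI)
      fix n assume "n \<ge> n0"
      then show "norm ((\<integral>\<zeta>. f \<zeta> \<partial>M n) - (\<integral>\<zeta>. f \<zeta> \<partial>N)) < e"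
        using n0[of n] fg[OF M[of n]] fg[OF N] unfolding real_norm_def by linarith
    qed
  qed
qed

lemma weak_conv_complex:
  fixes f :: "complex \<Rightarrow> complex"
  assumes w: "circle_weak_conv M N" and M: "\<And>n. circle_measure (M n)" and N: "circle_measure N"
    and f: "continuous_on (sphere 0 1) f"
  shows "(\<lambda>n. \<integral>\<zeta>. f \<zeta> \<partial>M n) \<longlonglongrightarrow> (\<integral>\<zeta>. f \<zeta> \<partial>N)"
proof -
  have *: "(\<integral>\<zeta>. f \<zeta> \<partial>L) = Complex (\<integral>\<zeta>. Re (f \<zeta>) \<partial>L) (\<integral>\<zeta>. Im (f \<zeta>) \<partial>L)" if "circle_measure L" for L
    using circle_integrable[OF that f] by (simp add: complex_eq_iff)
  have "continuous_on (sphere 0 1) (\<lambda>\<zeta>. Re (f \<zeta>))" "continuous_on (sphere 0 1) (\<lambda>\<zeta>. Im (f \<zeta>))"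
    using f by (auto intro: continuous_intros)
  then show ?thesis using w unfolding circle_weak_conv_def *[OF M] *[OF N]
    by (intro tendsto_Complex) auto
qed

text \<open>Equal moments give equal integrals of continuous functions; the indicator of a closed set is the
  decreasing limit of the functions \<open>max 0 (1 - n * dist(x, C))\<close>, and the closed sets generate the
  Borel sets.\<close>

lemma circle_prob_eqI:
  assumes M: "M \<in> circle_prob" and N: "N \<in> circle_prob"
    and eq: "\<And>j. moment M j = moment N j"
  shows "M = N"
proof -
  note M' = circle_prob_imp_circle_measure[OF M] and N' = circle_prob_imp_circle_measure[OF N]
  have "circle_weak_conv (\<lambda>_. M) N"
    by (rule fourier_coeff_tendsto_imp_weak_conv) (simp_all add: M N eq)
  then have int: "(\<integral>\<zeta>. f \<zeta> \<partial>M) = (\<integral>\<zeta>. f \<zeta> \<partial>N)" if "continuous_on (sphere 0 1) f" for f :: "complex \<Rightarrow> real"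
    using that unfolding circle_weak_conv_def by (metis LIMSEQ_const_iff)
  have cl: "emeasure M C = emeasure N C" if C: "closed C" "C \<subseteq> sphere 0 1" "C \<noteq> {}" for C
  proof -
    define f where "f n x = max 0 (1 - real n * infdist x C)" for n x
    have f: "continuous_on (sphere 0 1) (f n)" for n
      unfolding f_def by (intro continuous_intros)
    have f_lim: "(\<lambda>n. f n x) \<longlonglongrightarrow> indicator C x" for x
    proof (cases "x \<in> C")
      case True
      then show ?thesis by (simp add: f_def)
    next
      case False
      then have "infdist x C > 0" using in_closed_iff_infdist_zero[OF C(1,3), of x] infdist_nonneg[of x C] by force
      then have "filterlim (\<lambda>n. real n * infdist x C) at_top sequentially"
        by (subst mult.commute, intro filterlim_tendsto_pos_mult_at_top[OF tendsto_const] filterlim_real_sequentially)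
      then have "eventually (\<lambda>n. 1 \<le> real n * infdist x C) sequentially"
        unfolding filterlim_at_top by (rule spec)
      then have "eventually (\<lambda>n. f n x = 0) sequentially"
        by (rule eventually_mono) (simp add: f_def)
      then show ?thesis using False by (simp add: tendsto_eventually)
    qed
    have Cm: "C \<in> sets L" if "circle_measure L" for L
      using C unfolding circle_measureD(2)[OF that] circle_borel_def sets_restrict_space
      by (auto simp: image_iff intro!: bexI[of _ C])
    have L: "(\<lambda>n. \<integral>x. f n x \<partial>L) \<longlonglongrightarrow> measure L C" if L: "circle_measure L" for L
    proof -
      interpret finite_measure L using circle_measureD(1)[OF L] .
      have "(\<lambda>n. \<integral>x. f n x \<partial>L) \<longlonglongrightarrow> (\<integral>x. indicator C x \<partial>L)"
      proof (rule integral_dominated_convergence[where w = "\<lambda>_. 1"])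
        show "f n \<in> borel_measurable L" for n
          by (rule circle_measurable_continuous[OF circle_measureD(2)[OF L] f])
        show "AE x in L. norm (f n x) \<le> 1" for n
          by (auto simp: f_def infdist_nonneg)
      qed (use f_lim Cm[OF L] in auto)
      then show ?thesis using Cm[OF L] sets.sets_into_space[OF Cm[OF L]] by (simp add: Int_absorb1 Int_absorb2)
    qed
    have "measure M C = measure N C"
      using L[OF M'] L[OF N'] unfolding int[OF f] by (rule LIMSEQ_unique)
    then show ?thesis
      using finite_measure.emeasure_eq_measure[OF circle_measureD(1)[OF M']]
        finite_measure.emeasure_eq_measure[OF circle_measureD(1)[OF N']] by simp
  qed
  show ?thesis
  proof (rule measure_eqI_generator_eq[where E = "{C. closed C \<and> C \<subseteq> sphere 0 1}" and \<Omega> = "sphere 0 1" and A = "\<lambda>_. sphere 0 1"])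
    show "Int_stable {C. closed C \<and> C \<subseteq> (sphere 0 1 :: complex set)}"
      by (auto simp: Int_stable_def)
    show "emeasure M X = emeasure N X" if "X \<in> {C. closed C \<and> C \<subseteq> sphere 0 1}" for X
      using cl[of X] that by (cases "X = {}") auto
    have "sets circle_borel = sigma_sets (sphere 0 1) {C. closed C \<and> C \<subseteq> sphere 0 1}"
    proof -
      have "sets (borel :: complex measure) = sigma_sets UNIV (Collect closed)"
        unfolding borel_eq_closed by simp
      then have "sets circle_borel = sigma_sets (sphere 0 1) ((\<inter>) (sphere 0 1) ` Collect closed)"
        unfolding circle_borel_def sets_restrict_space
        by (simp add: restricted_sigma sigma_sets_sigma_sets_eq)
      also have "(\<inter>) (sphere 0 1) ` Collect closed = {C. closed C \<and> C \<subseteq> (sphere 0 1 :: complex set)}"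
        by (auto simp: image_iff)
      finally show ?thesis .
    qed
    then show "sets M = sigma_sets (sphere 0 1) {C. closed C \<and> C \<subseteq> sphere 0 1}"
       "sets N = sigma_sets (sphere 0 1) {C. closed C \<and> C \<subseteq> sphere 0 1}"
      using circle_measureD(2)[OF M'] circle_measureD(2)[OF N'] by auto
    show "emeasure M (sphere 0 1) \<noteq> \<infinity>" for i :: nat
      using finite_measure.emeasure_finite[OF circle_measureD(1)[OF M']] by simp
  qed auto
qed

section \<open>Weak compactness\<close>

text \<open>Cutting the circle open at \<open>-1\<close> turns circle measures into measures on a bounded interval of the
  line, where Helly's selection theorem applies. The limit on the line is wrapped back onto the
  circle; as \<open>cis\<close> is continuous on the line, the jump of the angle at \<open>-1\<close> does no harm.\<close>

lemma circle_prob_compact: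
  assumes M: "\<And>n. M n \<in> circle_prob"
  obtains r N where "strict_mono (r :: nat \<Rightarrow> nat)" "N \<in> circle_prob" "circle_weak_conv (M \<circ> r) N"
proof -
  note M' = circle_prob_imp_circle_measure[OF M]
  \<comment> \<open>a measurable angle in \<open>(- pi, pi]\<close>\<close>
  define \<theta> where "\<theta> \<zeta> = (if 0 \<le> Im \<zeta> then arccos (Re \<zeta>) else - arccos (Re \<zeta>))" for \<zeta>
  have Re_le: "\<bar>Re \<zeta>\<bar> \<le> 1" if "norm \<zeta> = 1" for \<zeta> :: complex
    using abs_Re_le_cmod[of \<zeta>] that by simp
  have \<theta>_meas: "\<theta> \<in> borel_measurable (M n)" for n
  proof -
    have cont: "continuous_on (sphere 0 1) (\<lambda>\<zeta>. arccos (Re \<zeta>))"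
    proof (rule continuous_on_arccos)
      show "continuous_on (sphere 0 1) Re" by (intro continuous_intros)
      show "\<forall>\<zeta>\<in>sphere 0 1. - 1 \<le> Re \<zeta> \<and> Re \<zeta> \<le> 1" using Re_le by (force simp: abs_le_iff)
    qed
    have m: "(\<lambda>\<zeta>. arccos (Re \<zeta>)) \<in> borel_measurable (M n)" "Im \<in> borel_measurable (M n)"
      by (intro circle_measurable_continuous[OF circle_measureD(2)[OF M'[of n]]] cont continuous_intros)+
    show ?thesis unfolding \<theta>_def using m by measurable
  qed
  have cis_\<theta>: "cis (\<theta> \<zeta>) = \<zeta>" if "norm \<zeta> = 1" for \<zeta>
  proof -
    have "(Re \<zeta>)\<^sup>2 + (Im \<zeta>)\<^sup>2 = 1" using that by (simp flip: cmod_power2)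
    then have "sqrt (1 - (Re \<zeta>)\<^sup>2) = \<bar>Im \<zeta>\<bar>" by (metis add_diff_cancel_left' real_sqrt_abs)
    then show ?thesis
      using Re_le[OF that] by (simp add: \<theta>_def complex_eq_iff sin_arccos_abs cos_arccos_abs)
  qed
  have \<theta>_bound: "\<theta> \<zeta> \<in> {-4<..4}" if "norm \<zeta> = 1" for \<zeta>
  proof -
    have "0 \<le> arccos (Re \<zeta>)" "arccos (Re \<zeta>) \<le> pi"
      using Re_le[OF that] by (auto intro!: arccos_lbound arccos_ubound simp: abs_le_iff)
    then show ?thesis using pi_less_4 by (auto simp: \<theta>_def)
  qed
  define R where "R n = distr (M n) borel \<theta>" for n
  have R: "real_distribution (R n)" for n
    unfolding R_def real_distribution_def real_distribution_axioms_def
    using M[of n] \<theta>_meas by (auto simp: circle_prob_def intro: prob_space.prob_space_distr)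
  have "tight R"
    unfolding tight_def
  proof (intro conjI allI impI R)
    fix e :: real assume e: "e > 0"
    \<comment> \<open>any bounds beyond \<open>pi\<close> serve here\<close>
    have "measure (R n) {-4<..4} = 1" for n
    proof -
      have "measure (R n) {-4<..4} = measure (M n) (\<theta> -` {-4<..4} \<inter> space (M n))"
        unfolding R_def by (rule measure_distr[OF \<theta>_meas]) simp
      also have "\<theta> -` {-4<..4} \<inter> space (M n) = space (M n)"
        using \<theta>_bound circle_measureD(3)[OF M'] by auto
      finally show ?thesis using circle_prob_measure_space[OF M] by simp
    qed
    then show "\<exists>a b. a < b \<and> (\<forall>n. 1 - e < measure (R n) {a<..b})"
      using e by (intro exI[of _ "-4"] exI[of _ 4]) simp
  qed
  then obtain r S where r: "strict_mono (r :: nat \<Rightarrow> nat)" and S: "real_distribution S"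
    and w: "weak_conv_m (R \<circ> id \<circ> r) S"
    using tight_imp_convergent_subsubsequence[of R id] strict_mono_id by blast
  define N where "N = distr S circle_borel cis"
  have cis: "cis \<in> measurable S circle_borel"
    unfolding circle_borel_def using S
    by (intro measurable_restrict_space2)
       (auto simp: real_distribution_def real_distribution_axioms_def cong: measurable_cong_sets intro!: borel_measurable_continuous_onI continuous_intros)
  have N: "N \<in> circle_prob"
    using S cis by (auto simp: N_def circle_prob_def real_distribution_def intro: prob_space.prob_space_distr)
  have "circle_weak_conv (M \<circ> r) N"
    unfolding circle_weak_conv_def
  proof (intro allI impI)
    fix f :: "complex \<Rightarrow> real" assume f: "continuous_on (sphere 0 1) f"
    have "compact (f ` sphere 0 1)"
      using f by (intro compact_continuous_image) auto
    then obtain B where B: "\<And>x. x \<in> sphere 0 1 \<Longrightarrow> norm (f x) \<le> B"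
      by (metis bounded_iff compact_imp_bounded imageI)
    have fc: "continuous_on UNIV (\<lambda>t. f (cis t))"
      by (rule continuous_on_compose2[OF f]) (auto intro!: continuous_intros)
    have "(\<lambda>n. integral\<^sup>L ((R \<circ> id \<circ> r) n) (\<lambda>t. f (cis t))) \<longlonglongrightarrow> integral\<^sup>L S (\<lambda>t. f (cis t))"
    proof (rule weak_conv_imp_integral_bdd_continuous_conv[OF _ S w])
      show "isCont (\<lambda>t. f (cis t)) x" for x
        using fc by (simp add: continuous_on_eq_continuous_at)
      show "norm (f (cis x)) \<le> B" for x using B[of "cis x"] by simp
    qed (use R in auto)
    moreover have "integral\<^sup>L (R n) (\<lambda>t. f (cis t)) = (\<integral>\<zeta>. f \<zeta> \<partial>M n)" for n
    proof -
      have "integral\<^sup>L (R n) (\<lambda>t. f (cis t)) = (\<integral>\<zeta>. f (cis (\<theta> \<zeta>)) \<partial>M n)"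
        unfolding R_def by (rule integral_distr[OF \<theta>_meas]) (use fc in \<open>rule borel_measurable_continuous_onI\<close>)
      also have "\<dots> = (\<integral>\<zeta>. f \<zeta> \<partial>M n)"
      proof (rule circle_integral_cong[OF M'])
        fix \<zeta> :: complex assume "norm \<zeta> = 1"
        then show "f (cis (\<theta> \<zeta>)) = f \<zeta>" by (simp add: cis_\<theta>)
      qed
      finally show ?thesis .
    qed
    moreover have "(\<integral>\<zeta>. f \<zeta> \<partial>N) = integral\<^sup>L S (\<lambda>t. f (cis t))"
      unfolding N_def by (rule integral_distr[OF cis]) (rule circle_measurable_continuous[OF refl f])
    ultimately show "(\<lambda>n. \<integral>\<zeta>. f \<zeta> \<partial>(M \<circ> r) n) \<longlonglongrightarrow> (\<integral>\<zeta>. f \<zeta> \<partial>N)"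
      by (simp add: o_def)
  qed
  then show ?thesis by (rule that[OF r N])
qed

lemma moment_tendsto_of_weak_conv:
  assumes "circle_weak_conv M N" "\<And>n. circle_measure (M n)" "circle_measure N"
  shows "(\<lambda>n. moment (M n) j) \<longlonglongrightarrow> moment N j"
  unfolding moment_def by (intro weak_conv_complex assms continuous_intros)

text \<open>The method of moments: a subsequence has a weak limit by compactness, its moments must be the
  given ones, and convergence of all moments then gives weak convergence of the full sequence.\<close>

lemma circle_prob_moment_limit:
  assumes M: "\<And>n. M n \<in> circle_prob" and lim: "\<And>j. (\<lambda>n. moment (M n) j) \<longlonglongrightarrow> c j"
  shows "\<exists>N\<in>circle_prob. (\<forall>j. moment N j = c j) \<and> circle_weak_conv M N"
proof -
  obtain r N where r: "strict_mono (r :: nat \<Rightarrow> nat)" and N: "N \<in> circle_prob"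
    and w: "circle_weak_conv (M \<circ> r) N"
    by (rule circle_prob_compact[of M, OF M])
  have "(\<lambda>n. moment ((M \<circ> r) n) j) \<longlonglongrightarrow> moment N j" for j
    by (rule moment_tendsto_of_weak_conv[OF w]) (auto intro: circle_prob_imp_circle_measure M N)
  moreover have "(\<lambda>n. moment ((M \<circ> r) n) j) \<longlonglongrightarrow> c j" for j
    using LIMSEQ_subseq_LIMSEQ[OF lim r] by (simp add: o_def)
  ultimately have eq: "moment N j = c j" for j by (rule LIMSEQ_unique)
  have "circle_weak_conv M N"
    by (rule fourier_coeff_tendsto_imp_weak_conv) (simp_all add: M N eq lim)
  with N eq show ?thesis by blast
qed

section \<open>The Herglotz representation\<close>

text \<open>Cauchy's integral formulas for \<open>F(u) / u ^ (j + 1)\<close> and for \<open>F(u) * u ^ j / u\<close> on the circle of radius \<open>r\<close>: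
  the boundary values of a holomorphic function have no Fourier coefficients of negative index.\<close>

lemma fourier_integral_holomorphic:
  fixes F :: "complex \<Rightarrow> complex" and r :: real
  assumes F: "F holomorphic_on ball 0 1" and r: "0 < r" "r < 1"
  shows "((\<lambda>t. F (r * cis t) * cis (- (real j * t))) has_integral
            2 * pi * r ^ j * ((deriv ^^ j) F 0 / fact j)) {0..2 * pi}"
    and "((\<lambda>t. F (r * cis t) * cis (real j * t)) has_integral 2 * pi * (0 ^ j * F 0)) {0..2 * pi}"
proof -
  have cont: "continuous_on (cball 0 r) F"
    by (rule holomorphic_on_imp_continuous_on, rule holomorphic_on_subset[OF F]) (use r in auto)
  have hol: "F holomorphic_on ball 0 r"
    by (rule holomorphic_on_subset[OF F]) (use r in auto)
  have 0: "0 \<in> ball (0::complex) r" using r by simp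
  have circ: "circlepath 0 r = part_circlepath 0 r 0 (2 * pi)" by (simp add: circlepath_def)
  have cis_inv: "inverse (cis t) = cis (- t)" for t by (simp add: cis_inverse)
  have "((\<lambda>u. F u / (u - 0) ^ Suc j) has_contour_integral
           (2 * pi * \<i>) / fact j * (deriv ^^ j) F 0) (circlepath 0 r)"
    by (rule Cauchy_has_contour_integral_higher_derivative_circlepath[OF cont hol 0])
  then have "((\<lambda>t. F (r * cis t) / (r * cis t) ^ Suc j * r * \<i> * cis t) has_integral
          (2 * pi * \<i>) / fact j * (deriv ^^ j) F 0) {0..2 * pi}"
    unfolding circ by (subst (asm) has_contour_integral_part_circlepath_iff) simp_all
  then have "((\<lambda>t. (r ^ j / \<i>) * (F (r * cis t) / (r * cis t) ^ Suc j * r * \<i> * cis t)) has_integral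
          (r ^ j / \<i>) * ((2 * pi * \<i>) / fact j * (deriv ^^ j) F 0)) {0..2 * pi}"
    by (rule has_integral_mult_right)
  moreover have "(r ^ j / \<i>) * (F (r * cis t) / (r * cis t) ^ Suc j * r * \<i> * cis t)
      = F (r * cis t) * cis (- (real j * t))" for t
  proof -
    have "cis (- (real j * t)) = inverse (cis t ^ j)" unfolding Complex.DeMoivre cis_inv ..
    then show ?thesis using r by (simp add: field_simps power_mult_distrib)
  qed
  ultimately show "((\<lambda>t. F (r * cis t) * cis (- (real j * t))) has_integral
            2 * pi * r ^ j * ((deriv ^^ j) F 0 / fact j)) {0..2 * pi}"
    by (simp add: field_simps)
  have "((\<lambda>u. (F u * u ^ j) / (u - 0) ^ Suc 0) has_contour_integral
           (2 * pi * \<i>) / fact 0 * (deriv ^^ 0) (\<lambda>u. F u * u ^ j) 0) (circlepath 0 r)"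
    by (intro Cauchy_has_contour_integral_higher_derivative_circlepath continuous_intros
        holomorphic_intros cont hol 0)
  then have "((\<lambda>t. (F (r * cis t) * (r * cis t) ^ j) / (r * cis t) * r * \<i> * cis t) has_integral
          (2 * pi * \<i>) * (F 0 * 0 ^ j)) {0..2 * pi}"
    unfolding circ by (subst (asm) has_contour_integral_part_circlepath_iff) simp_all
  then have "((\<lambda>t. (1 / (\<i> * r ^ j)) * ((F (r * cis t) * (r * cis t) ^ j) / (r * cis t) * r * \<i> * cis t)) has_integral
         (1 / (\<i> * r ^ j)) * ((2 * pi * \<i>) * (F 0 * 0 ^ j))) {0..2 * pi}"
    by (rule has_integral_mult_right)
  moreover have "(1 / (\<i> * r ^ j)) * ((F (r * cis t) * (r * cis t) ^ j) / (r * cis t) * r * \<i> * cis t)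
      = F (r * cis t) * cis (real j * t)" for t
    using r by (simp add: field_simps power_mult_distrib Complex.DeMoivre)
  moreover have "(1 / (\<i> * r ^ j)) * ((2 * pi * \<i>) * (F 0 * 0 ^ j)) = 2 * pi * (0 ^ j * F 0)"
    by (cases j) simp_all
  ultimately show "((\<lambda>t. F (r * cis t) * cis (real j * t)) has_integral 2 * pi * (0 ^ j * F 0)) {0..2 * pi}"
    by simp
qed

text \<open>The measure has density \<open>Re (F (r * cis t)) / (2 * pi)\<close> on \<open>[0, 2 * pi]\<close>. It is moved to the circle by
  \<open>t \<mapsto> cis (- t)\<close>, since moments of nonnegative index integrate \<open>\<zeta> ^ j\<close> whereas Taylor coefficients
  are read off by integrating against \<open>cis (- j * t)\<close>. The term \<open>0 ^ j\<close> comes from the conjugate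
  half of the real part, which contributes to the constant coefficient only.\<close>

lemma herglotz_dilated:
  assumes F: "F holomorphic_on ball 0 1" and ReF: "\<And>z. norm z < 1 \<Longrightarrow> Re (F z) \<ge> 0"
    and F0: "F 0 = 1" and r: "0 < r" "r < 1"
  obtains M where "M \<in> circle_prob"
    "\<And>j. moment M j = (of_real r ^ j * ((deriv ^^ j) F 0 / fact j) + 0 ^ j) / 2"
proof -
  define \<rho> where "\<rho> t = Re (F (of_real r * cis t))" for t
  have in_ball: "of_real r * cis t \<in> ball 0 1" for t using r by (simp add: norm_mult)
  have \<rho>_cont: "continuous_on UNIV \<rho>"
  proof -
    have "continuous_on UNIV (\<lambda>t. of_real r * cis t)" by (intro continuous_intros)
    then have "continuous_on UNIV (\<lambda>t. F (of_real r * cis t))"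
      by (rule continuous_on_compose2[where g = F and f = "\<lambda>t. of_real r * cis t" and t = "ball 0 1",
            OF holomorphic_on_imp_continuous_on[OF F]]) (use in_ball in auto)
    then show ?thesis unfolding \<rho>_def by (rule continuous_on_Re)
  qed
  have \<rho>_nonneg: "\<rho> t \<ge> 0" for t using ReF in_ball[of t] by (simp add: \<rho>_def)
  have fourier: "((\<lambda>t. of_real (\<rho> t) * cis (- (real j * t))) has_integral
        pi * (of_real r ^ j * ((deriv ^^ j) F 0 / fact j) + 0 ^ j)) {0..2 * pi}" for j
  proof -
    have "((\<lambda>t. cnj (F (r * cis t) * cis (real j * t))) has_integral cnj (2 * pi * (0 ^ j * F 0))) {0..2 * pi}"
      by (rule iffD2[OF has_integral_cnj[unfolded o_def] fourier_integral_holomorphic(2)[OF F r, of j]])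
    then have "((\<lambda>t. (1 / 2) * (F (r * cis t) * cis (- (real j * t)) + cnj (F (r * cis t) * cis (real j * t)))) has_integral
      (1 / 2) * (2 * pi * r ^ j * ((deriv ^^ j) F 0 / fact j) + cnj (2 * pi * (0 ^ j * F 0)))) {0..2 * pi}"
      using fourier_integral_holomorphic(1)[OF F r, of j] by (intro has_integral_mult_right has_integral_add)
    moreover have "(1 / 2) * (F (r * cis t) * cis (- (real j * t)) + cnj (F (r * cis t) * cis (real j * t)))
       = of_real (\<rho> t) * cis (- (real j * t))" for t
    proof -
      have "(1 / 2) * (F (r * cis t) * cis (- (real j * t)) + cnj (F (r * cis t) * cis (real j * t)))
         = ((F (r * cis t) + cnj (F (r * cis t))) / 2) * cis (- (real j * t))"
        by (simp add: cis_cnj field_simps)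
      also have "(F (r * cis t) + cnj (F (r * cis t))) / 2 = of_real (\<rho> t)"
        by (simp add: complex_add_cnj \<rho>_def)
      finally show ?thesis .
    qed
    moreover have "(1 / 2) * (2 * pi * r ^ j * ((deriv ^^ j) F 0 / fact j) + cnj (2 * pi * (0 ^ j * F 0)))
        = pi * (of_real r ^ j * ((deriv ^^ j) F 0 / fact j) + 0 ^ j)"
      by (simp add: F0 field_simps)
    ultimately show ?thesis by simp
  qed
  define g where "g t = indicator {0..2 * pi} t * \<rho> t / (2 * pi)" for t
  have g_meas: "g \<in> borel_measurable lborel"
    unfolding g_def using borel_measurable_continuous_onI[OF \<rho>_cont] by measurable
  have g_nonneg: "g t \<ge> 0" for t using \<rho>_nonneg by (simp add: g_def)
  have g_integral: "integrable lborel (\<lambda>t. g t *\<^sub>R cis (- (real j * t)))"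
      "(\<integral>t. g t *\<^sub>R cis (- (real j * t)) \<partial>lborel) = (of_real r ^ j * ((deriv ^^ j) F 0 / fact j) + 0 ^ j) / 2" for j
  proof -
    have "continuous_on {0..2 * pi} (\<lambda>t. of_real (\<rho> t) * cis (- (real j * t)))"
      by (intro continuous_intros continuous_on_subset[OF \<rho>_cont]) auto
    then have int: "set_integrable lborel {0..2 * pi} (\<lambda>t. of_real (\<rho> t) * cis (- (real j * t)))"
      by (rule borel_integrable_atLeastAtMost')
    have e: "(\<lambda>t. g t *\<^sub>R cis (- (real j * t))) = (\<lambda>t. (1 / (2 * pi)) *\<^sub>R (indicator {0..2 * pi} t *\<^sub>R (of_real (\<rho> t) * cis (- (real j * t)))))"
      by (simp add: g_def fun_eq_iff scaleR_conv_of_real indicator_def)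
    show "integrable lborel (\<lambda>t. g t *\<^sub>R cis (- (real j * t)))"
      unfolding e by (intro integrable_scaleR_right) (use int in \<open>simp only: set_integrable_def\<close>)
    have "(\<integral>t. g t *\<^sub>R cis (- (real j * t)) \<partial>lborel)
        = (1 / (2 * pi)) *\<^sub>R (LINT t:{0..2 * pi}|lborel. of_real (\<rho> t) * cis (- (real j * t)))"
      unfolding e set_lebesgue_integral_def by (rule integral_scaleR_right)
    also have "(LINT t:{0..2 * pi}|lborel. of_real (\<rho> t) * cis (- (real j * t)))
        = pi * (of_real r ^ j * ((deriv ^^ j) F 0 / fact j) + 0 ^ j)"
      using set_borel_integral_eq_integral(2)[OF int] integral_unique[OF fourier[of j]] by simp
    also have "(1 / (2 * pi)) *\<^sub>R (pi * c) = c / 2" for c :: complex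
      by (simp add: scaleR_conv_of_real)
    finally show "(\<integral>t. g t *\<^sub>R cis (- (real j * t)) \<partial>lborel) = (of_real r ^ j * ((deriv ^^ j) F 0 / fact j) + 0 ^ j) / 2" .
  qed
  define D where "D = density lborel (\<lambda>t. ennreal (g t))"
  have int_g: "integrable lborel g" "(\<integral>t. g t \<partial>lborel) = 1"
  proof -
    have e: "(\<lambda>t. g t *\<^sub>R cis (- (real 0 * t))) = (\<lambda>t. complex_of_real (g t))"
      by (simp add: fun_eq_iff scaleR_conv_of_real)
    show "integrable lborel g"
      using g_integral(1)[of 0] unfolding e by (simp only: complex_of_real_integrable_eq)
    have "complex_of_real (\<integral>t. g t \<partial>lborel) = 1"
      using g_integral(2)[of 0] unfolding e integral_complex_of_real by (simp add: F0)
    then show "(\<integral>t. g t \<partial>lborel) = 1" by simp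
  qed
  have D: "prob_space D"
  proof
    have "emeasure D (space D) = (\<integral>\<^sup>+t. ennreal (g t) \<partial>lborel)"
      unfolding D_def using g_meas by (subst emeasure_density) auto
    also have "\<dots> = 1"
      by (subst nn_integral_eq_integral) (use int_g g_nonneg in auto)
    finally show "emeasure D (space D) = 1" .
  qed
  define M where "M = distr D circle_borel (\<lambda>t. cis (- t))"
  have cis_meas: "(\<lambda>t. cis (- t)) \<in> measurable D circle_borel"
    unfolding circle_borel_def D_def measurable_density_eq1 measurable_lborel1
    by (intro measurable_restrict_space2) (auto intro!: borel_measurable_continuous_onI continuous_intros)
  have M: "M \<in> circle_prob"
    unfolding circle_prob_def M_def by (simp add: prob_space.prob_space_distr[OF D cis_meas])
  show ?thesis
  proof (rule that[OF M])
    fix j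
    have "moment M j = (\<integral>t. cis (- t) ^ j \<partial>D)"
      unfolding M_def moment_def
      by (rule integral_distr[OF cis_meas])
         (rule circle_measurable_continuous[OF refl], intro continuous_intros)
    also have "\<dots> = (\<integral>t. cis (- (real j * t)) \<partial>D)" by (simp add: Complex.DeMoivre)
    also have "\<dots> = (\<integral>t. g t *\<^sub>R cis (- (real j * t)) \<partial>lborel)"
      unfolding D_def
      by (rule integral_density)
         (use g_meas g_nonneg in \<open>auto intro!: borel_measurable_continuous_onI continuous_intros\<close>)
    also note g_integral(2)[of j]
    finally show "moment M j = (of_real r ^ j * ((deriv ^^ j) F 0 / fact j) + 0 ^ j) / 2" .
  qed
qed

text \<open>Let \<open>r \<rightarrow> 1\<close> in the dilated representation; weak compactness supplies the limit measure. The
  integrand of the classical formula, \<open>(1 + \<zeta>z) / (1 - \<zeta>z)\<close>, equals \<open>2 / (1 - \<zeta>z) - 1\<close>.\<close>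

theorem herglotz_representation:
  assumes F: "F holomorphic_on ball 0 1" and ReF: "\<And>z. norm z < 1 \<Longrightarrow> Re (F z) \<ge> 0"
    and F0: "F 0 = 1"
  shows "\<exists>M\<in>circle_prob. \<forall>z. norm z < 1 \<longrightarrow> 2 * cauchy_transform M z - 1 = F z"
proof -
  define c where "c j = (deriv ^^ j) F 0 / fact j" for j
  define r where "r n = 1 - 1 / (real n + 2)" for n
  have r: "0 < r n" "r n < 1" for n by (auto simp: r_def)
  have r_lim: "r \<longlonglongrightarrow> 1" unfolding r_def by real_asymp
  have "\<exists>M. M \<in> circle_prob \<and> (\<forall>j. moment M j = (of_real (r n) ^ j * c j + 0 ^ j) / 2)" for n
    unfolding c_def by (rule herglotz_dilated[OF F ReF F0 r[of n]]) auto
  then obtain M where M: "\<And>n. M n \<in> circle_prob"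
      and mom: "\<And>n j. moment (M n) j = (of_real (r n) ^ j * c j + 0 ^ j) / 2"
    by metis
  have lim: "(\<lambda>n. moment (M n) j) \<longlonglongrightarrow> (of_real 1 ^ j * c j + 0 ^ j) / 2" for j
    unfolding mom by (intro tendsto_intros r_lim) auto
  obtain N where N: "N \<in> circle_prob" "\<And>j. moment N j = (of_real 1 ^ j * c j + 0 ^ j) / 2"
    using circle_prob_moment_limit[OF M lim] by blast
  show ?thesis
  proof (intro bexI[OF _ N(1)] allI impI)
    fix z :: complex assume z: "norm z < 1"
    have "(\<lambda>j. c j * (z - 0) ^ j) sums F z"
      unfolding c_def by (rule holomorphic_power_series[OF F]) (use z in simp)
    moreover have "(\<lambda>j. 0 ^ j * z ^ j) sums 1"
      using powser_sums_zero[of "\<lambda>_. 1 :: complex"] sums_single[of 0 "\<lambda>j. 1 :: complex"]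
      by (rule_tac iffD1[OF sums_cong, of "\<lambda>j. if j = 0 then 1 else 0"]) (auto simp: power_0_left)
    ultimately have "(\<lambda>j. (c j * (z - 0) ^ j + 0 ^ j * z ^ j) / 2) sums ((F z + 1) / 2)"
      by (intro sums_divide sums_add)
    moreover have "(\<lambda>j. (c j * (z - 0) ^ j + 0 ^ j * z ^ j) / 2) = (\<lambda>j. moment N j * z ^ j)"
      by (simp add: N(2) fun_eq_iff field_simps)
    ultimately have "cauchy_transform N z = (F z + 1) / 2"
      using cauchy_transform_sums[OF circle_prob_imp_circle_measure[OF N(1)] z] sums_unique2 by metis
    then show "2 * cauchy_transform N z - 1 = F z" by (simp add: field_simps)
  qed
qed

section \<open>Convergence of power series coefficients\<close>

text \<open>Once the coefficients below \<open>j\<close> tend to \<open>0\<close>, dividing the series at a small \<open>x > 0\<close> by \<open>x ^ j\<close> leaves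
  the \<open>j\<close>-th coefficient up to a tail of size at most \<open>2 * C * x\<close>, uniformly in \<open>n\<close>.\<close>

lemma powser_coeff_tendsto_0:
  fixes c :: "nat \<Rightarrow> nat \<Rightarrow> complex"
  assumes bound: "\<And>n j. norm (c n j) \<le> C" and \<delta>: "\<delta> > 0"
    and lim: "\<And>x. 0 < x \<Longrightarrow> x < \<delta> \<Longrightarrow> (\<lambda>n. \<Sum>j. c n j * of_real x ^ j) \<longlonglongrightarrow> 0"
  shows "(\<lambda>n. c n j) \<longlonglongrightarrow> 0"
proof (induction j rule: less_induct)
  case (less j)
  have C: "C \<ge> 0" using bound[of 0 0] norm_ge_zero order_trans by blast
  show ?case
  proof (rule LIMSEQ_I)
    fix e :: real assume e: "e > 0"
    \<comment> \<open>the tail below is at most \<open>2 * C * x\<close>, so this choice makes it at most \<open>e / 2\<close>\<close>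
    define x where "x = min (\<delta> / 2) (min (1 / 2) (e / (4 * (C + 1))))"
    have x: "0 < x" "x < \<delta>" "x \<le> 1 / 2" "x \<le> e / (4 * (C + 1))"
      using \<delta> e C by (simp add: x_def, simp add: x_def min_less_iff_disj, unfold x_def, linarith, linarith)
    have "2 * C * x \<le> 2 * (C + 1) * x" using x by (intro mult_right_mono) auto
    also have "\<dots> \<le> 2 * (C + 1) * (e / (4 * (C + 1)))" using x C by (intro mult_left_mono) auto
    also have "\<dots> = e / 2" using C by (simp add: field_simps)
    finally have xe: "2 * C * x \<le> e / 2" .
    define g where "g n = ((\<Sum>i. c n i * of_real x ^ i) - (\<Sum>i<j. c n i * of_real x ^ i)) / of_real x ^ j" for n
    have "g \<longlonglongrightarrow> (0 - (\<Sum>i<j. 0 * of_real x ^ i)) / of_real x ^ j"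
      unfolding g_def using less x by (intro tendsto_intros lim) auto
    then have "g \<longlonglongrightarrow> 0" by simp
    from LIMSEQ_D[OF this, of "e / 2"] e obtain n0 where n0: "\<And>n. n \<ge> n0 \<Longrightarrow> norm (g n) < e / 2" by auto
    have close: "norm (c n j - g n) \<le> 2 * C * x" for n
    proof -
      have geo: "summable (\<lambda>i. C * x ^ i)" using x by (intro summable_mult summable_geometric) auto
      have le: "norm (c n i * of_real x ^ i) \<le> C * x ^ i" for i
        using bound[of n i] x by (simp add: norm_mult norm_power mult_right_mono)
      have sm: "summable (\<lambda>i. c n i * of_real x ^ i)"
        by (rule summable_comparison_test'[OF geo le])
      define t where "t = (\<Sum>i. c n (i + Suc j) * of_real x ^ (i + Suc j))"
      have "(\<Sum>i. c n i * of_real x ^ i) = t + (\<Sum>i<Suc j. c n i * of_real x ^ i)"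
        unfolding t_def by (rule suminf_split_initial_segment[OF sm])
      then have "c n j - g n = - (t / of_real x ^ j)"
        using x by (simp add: g_def field_simps)
      then have "norm (c n j - g n) = norm t / x ^ j"
        using x by (simp add: norm_divide norm_power)
      also have "norm t \<le> (\<Sum>i. C * x ^ (i + Suc j))"
        unfolding t_def using le[of "_ + Suc j"] geo
        by (intro norm_suminf_le) (auto simp only: summable_iff_shift[of "\<lambda>i. C * x ^ i"])
      also have "(\<Sum>i. C * x ^ (i + Suc j)) = C * x ^ Suc j * (1 / (1 - x))"
      proof -
        have "(\<lambda>i. C * x ^ Suc j * x ^ i) sums (C * x ^ Suc j * (1 / (1 - x)))"
          using x by (intro sums_mult geometric_sums) auto
        then show ?thesis by (simp add: power_add sums_iff mult_ac)
      qed
      also have "1 / (1 - x) \<le> 2" using x by (simp add: field_simps)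
      also have "C * x ^ Suc j * 2 / x ^ j = 2 * C * x" using x by simp
      finally show ?thesis using x C by (simp add: divide_right_mono mult_left_mono)
    qed
    show "\<exists>n0. \<forall>n\<ge>n0. norm (c n j - 0) < e"
    proof (intro exI allI impI)
      fix n assume "n \<ge> n0"
      have "norm (c n j) \<le> norm (c n j - g n) + norm (g n)"
        by (metis diff_add_cancel norm_triangle_ineq)
      then show "norm (c n j - 0) < e" using n0[OF \<open>n \<ge> n0\<close>] close[of n] xe by simp
    qed
  qed
qed

text \<open>The moments are the Taylor coefficients of the Cauchy transform; a constant sequence of power
  series that vanish near \<open>0\<close> has vanishing coefficients by the preceding lemma.\<close>

lemma cauchy_transform_determines:
  assumes M: "M \<in> circle_prob" and N: "N \<in> circle_prob"
    and eq: "\<And>z. norm z < 1 \<Longrightarrow> z \<noteq> 0 \<Longrightarrow> cauchy_transform M z = cauchy_transform N z"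
  shows "M = N"
proof (rule circle_prob_eqI[OF M N])
  fix j
  note M' = circle_prob_imp_circle_measure[OF M] and N' = circle_prob_imp_circle_measure[OF N]
  have "(\<lambda>n::nat. moment M j - moment N j) \<longlonglongrightarrow> 0"
  proof (rule powser_coeff_tendsto_0[where C = 2 and \<delta> = 1])
    show "norm (moment M j - moment N j) \<le> 2" for j
      using norm_moment_le[OF M', of j] norm_moment_le[OF N', of j]
        norm_triangle_ineq4[of "moment M j" "moment N j"]
      by (simp add: circle_prob_measure_space M N)
    fix x :: real assume x: "0 < x" "x < 1"
    then have z: "norm (of_real x :: complex) < 1" "complex_of_real x \<noteq> 0" by auto
    have "(\<lambda>j. moment M j * of_real x ^ j - moment N j * of_real x ^ j) sums
       (cauchy_transform M (of_real x) - cauchy_transform N (of_real x))"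
      by (intro sums_diff cauchy_transform_sums M' N' z)
    then have "(\<Sum>j. (moment M j - moment N j) * of_real x ^ j) = 0"
      using eq[OF z] by (simp add: sums_iff left_diff_distrib)
    then show "(\<lambda>n::nat. \<Sum>j. (moment M j - moment N j) * of_real x ^ j) \<longlonglongrightarrow> 0" by simp
  qed auto
  then show "moment M j = moment N j" by (simp add: LIMSEQ_const_iff)
qed

section \<open>The B-transform\<close>

lemma psi_transform_eq:
  assumes M: "M \<in> circle_prob" and z: "norm z < 1"
  shows "psi_transform M z = cauchy_transform M z - 1"
proof -
  note M' = circle_prob_imp_circle_measure[OF M]
  have int: "integrable M (\<lambda>\<zeta>. 1 / (1 - \<zeta> * z))"
    by (intro circle_integrable M' continuous_intros) (use one_minus_mult_nonzero z in auto)
  have int1: "integrable M (\<lambda>\<zeta>. 1 :: complex)"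
    by (intro circle_integrable M' continuous_on_const)
  have "psi_transform M z = (\<integral>\<zeta>. 1 / (1 - \<zeta> * z) - 1 \<partial>M)"
    unfolding psi_transform_def
    by (rule circle_integral_cong[OF M']) (use one_minus_mult_nonzero z in \<open>auto simp: field_simps\<close>)
  also have "\<dots> = cauchy_transform M z - 1"
    using int int1 circle_prob_measure_space[OF M] by (simp add: cauchy_transform_def)
  finally show ?thesis .
qed

lemma cauchy_transform_0: "M \<in> circle_prob \<Longrightarrow> cauchy_transform M 0 = 1"
  by (simp add: cauchy_transform_def circle_prob_measure_space)

lemma deriv_cauchy_transform_0:
  assumes M: "circle_measure M"
  shows "deriv (cauchy_transform M) 0 = moment M 1"
proof -
  define f where "f z = (\<Sum>j. moment M j * z ^ j)" for z
  have "summable (\<lambda>j. moment M j * (1 / 2) ^ j)"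
    using cauchy_transform_sums[OF M, of "1 / 2"] by (simp add: sums_iff)
  then have "(f has_field_derivative (\<Sum>j. diffs (moment M) j * 0 ^ j)) (at 0)"
    unfolding f_def by (rule termdiffs_strong) simp
  then have "(f has_field_derivative moment M 1) (at 0)"
    by (simp add: powser_zero diffs_def)
  then have "(cauchy_transform M has_field_derivative moment M 1) (at 0)"
    by (rule has_field_derivative_transform_within_open[where S = "ball 0 1"])
       (use cauchy_transform_sums[OF M] in \<open>auto simp: f_def sums_iff\<close>)
  then show ?thesis by (rule DERIV_imp_deriv)
qed

text \<open>With the Cauchy transform \<open>G = 1 + \<psi>\<close>, the function in the definition of \<open>B\<close> is \<open>(G - 1) / (z * G)\<close>.
  As \<open>G(0) = 1\<close> and \<open>G\<close> has no zeros, its singularity at \<open>0\<close> is removed by the difference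
  quotient \<open>h\<close> of \<open>G\<close>. The identity \<open>(1 - z * B) * G = 1\<close> is the form in which \<open>B\<close> is used below.\<close>

lemma
  assumes M: "M \<in> circle_prob"
  shows B_transform_holomorphic: "B_transform M holomorphic_on ball 0 1"
    and B_transform_cauchy_transform: "norm z < 1 \<Longrightarrow> (1 - z * B_transform M z) * cauchy_transform M z = 1"
    and B_transform_0: "B_transform M 0 = moment M 1"
proof -
  note M' = circle_prob_imp_circle_measure[OF M]
  let ?G = "cauchy_transform M"
  define h where "h = (\<lambda>z. if z = 0 then deriv ?G 0 else (?G z - ?G 0) / (z - 0))"
  have h: "h holomorphic_on ball 0 1"
    unfolding h_def by (rule pole_lemma[OF cauchy_transform_holomorphic[OF M']]) simp
  have G_nz: "?G z \<noteq> 0" if "z \<in> ball 0 1" for z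
    using Re_cauchy_transform[OF M, of z] that by auto
  have hG: "(\<lambda>z. h z / ?G z) holomorphic_on ball 0 1"
    using G_nz by (intro holomorphic_intros h cauchy_transform_holomorphic M') auto
  have B: "B_transform M z = h z / ?G z" if z: "z \<in> ball 0 1" for z
    unfolding B_transform_def
  proof (rule remove_sings_eqI)
    have "isCont (\<lambda>z. h z / ?G z) z"
      using hG z holomorphic_on_imp_continuous_on continuous_on_eq_continuous_at open_ball by blast
    then have lim: "(\<lambda>z. h z / ?G z) \<midarrow>z\<rightarrow> h z / ?G z" by (rule isContD)
    have "eventually (\<lambda>w. w \<in> ball 0 1 - {0}) (at z)"
    proof (cases "z = 0")
      case True
      then show ?thesis using eventually_at_in_open[of "ball 0 1" z] by simp
    next
      case False
      then show ?thesis using z by (intro eventually_at_in_open' open_delete open_ball) auto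
    qed
    then have "eventually (\<lambda>w. h w / ?G w = 1 / w * (psi_transform M w / (1 + psi_transform M w))) (at z)"
      by (rule eventually_mono)
         (simp add: h_def psi_transform_eq[OF M] cauchy_transform_0[OF M])
    then show "(\<lambda>w. 1 / w * (psi_transform M w / (1 + psi_transform M w))) \<midarrow>z\<rightarrow> h z / ?G z"
      by (rule Lim_transform_eventually[OF lim])
  qed
  show "B_transform M holomorphic_on ball 0 1"
    using hG by (rule holomorphic_transform) (simp add: B)
  show "(1 - z * B_transform M z) * cauchy_transform M z = 1" if "norm z < 1"
    using that G_nz[of z] by (simp add: B h_def field_simps cauchy_transform_0[OF M])
  show "B_transform M 0 = moment M 1"
    by (simp add: B h_def cauchy_transform_0[OF M] deriv_cauchy_transform_0[OF M'])
qed

text \<open>Since \<open>Re G > 1/2\<close>, the function \<open>z * B(z) = (G - 1) / G\<close> maps the disk into itself and vanishes at \<open>0\<close>;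
  Schwarz's lemma gives \<open>|z * B(z)| \<le> |z|\<close>.\<close>

lemma norm_B_transform_le_1:
  assumes M: "M \<in> circle_prob" and z: "norm z < 1"
  shows "norm (B_transform M z) \<le> 1"
proof -
  have hol: "(\<lambda>z. z * B_transform M z) holomorphic_on ball 0 1"
    by (intro holomorphic_intros B_transform_holomorphic[OF M])
  have lt: "norm (w * B_transform M w) < 1" if w: "norm w < 1" for w
  proof -
    let ?G = "cauchy_transform M w"
    have G: "Re ?G > 1 / 2" using Re_cauchy_transform[OF M w] .
    then have nz: "?G \<noteq> 0" by auto
    have "(norm (?G - 1))\<^sup>2 = (norm ?G)\<^sup>2 - 2 * Re ?G + 1"
      unfolding cmod_power2 by (simp add: power2_eq_square algebra_simps)
    also have "\<dots> < (norm ?G)\<^sup>2" using G by simp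
    finally have "norm (?G - 1) < norm ?G" by (rule power2_less_imp_less) simp
    moreover have "w * B_transform M w = (?G - 1) / ?G"
      using B_transform_cauchy_transform[OF M w] nz by (simp add: field_simps)
    ultimately show ?thesis using nz by (simp add: norm_divide)
  qed
  have le: "norm (B_transform M w) \<le> 1" if w: "norm w < 1" "w \<noteq> 0" for w
    using Schwarz_Lemma(1)[OF hol _ lt w(1)] w by (simp add: norm_mult)
  show ?thesis
  proof (cases "z = 0")
    case True
    then show ?thesis using norm_moment_le[OF circle_prob_imp_circle_measure[OF M], of 1] B_transform_0[OF M]
      by (simp add: circle_prob_measure_space[OF M])
  qed (use le z in auto)
qed

lemma B_transform_inj:
  assumes M: "M \<in> circle_prob" and N: "N \<in> circle_prob"
    and eq: "\<And>z. z \<in> ball 0 1 \<Longrightarrow> B_transform M z = B_transform N z"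
  shows "M = N"
proof (rule cauchy_transform_determines[OF M N])
  fix z :: complex assume z: "norm z < 1"
  show "cauchy_transform M z = cauchy_transform N z"
    using B_transform_cauchy_transform[OF M z] B_transform_cauchy_transform[OF N z] eq[of z] z
    by (metis mem_ball_0 mult_cancel_left mult_zero_left zero_neq_one)
qed

lemma Re_herglotz_kernel_nonneg:
  assumes "norm w < 1" shows "Re ((1 + w) / (1 - w)) \<ge> 0"
proof -
  define q where "q = 1 / (1 - w)"
  have "w \<noteq> 1" using assms by auto
  then have "(1 + w) / (1 - w) = 2 * q - 1" by (simp add: q_def field_simps)
  moreover have "0 \<le> 1 - (norm w)\<^sup>2" using assms by (simp add: abs_square_le_1)
  then have "Re q \<ge> 1 / 2" using Re_inverse_one_minus[OF assms] unfolding q_def[symmetric] by argo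
  ultimately show ?thesis by simp
qed

text \<open>The function \<open>(1 + z * \<beta>(z)) / (1 - z * \<beta>(z))\<close> has nonnegative real part, hence a Herglotz
  measure, and for this measure \<open>G = 1 / (1 - z * \<beta>(z))\<close>.\<close>

lemma B_transform_surj:
  assumes \<beta>: "\<beta> holomorphic_on ball 0 1" and le: "\<And>z. norm z < 1 \<Longrightarrow> norm (\<beta> z) \<le> 1"
  shows "\<exists>M\<in>circle_prob. \<forall>z\<in>ball 0 1. B_transform M z = \<beta> z"
proof -
  define F where "F = (\<lambda>z. 2 / (1 - z * \<beta> z) - 1)"
  have lt: "norm (z * \<beta> z) < 1" if "norm z < 1" for z
    using that mult_left_mono[OF le[OF that] norm_ge_zero[of z]] unfolding norm_mult by linarith
  have nz: "1 - z * \<beta> z \<noteq> 0" if "norm z < 1" for z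
    using lt[OF that] by (metis eq_iff_diff_eq_0 less_irrefl norm_one)
  have hol: "F holomorphic_on ball 0 1"
    unfolding F_def using nz by (intro holomorphic_intros \<beta>) auto
  have ReF: "Re (F z) \<ge> 0" if "norm z < 1" for z
  proof -
    have "F z = (1 + z * \<beta> z) / (1 - z * \<beta> z)" using nz[OF that] by (simp add: F_def field_simps)
    then show ?thesis using Re_herglotz_kernel_nonneg[OF lt[OF that]] by simp
  qed
  have F0: "F 0 = 1" by (simp add: F_def)
  have "\<exists>M\<in>circle_prob. \<forall>z. norm z < 1 \<longrightarrow> 2 * cauchy_transform M z - 1 = F z"
    by (rule herglotz_representation[OF hol ReF F0])
  then obtain M where M: "M \<in> circle_prob" and G: "\<forall>z. norm z < 1 \<longrightarrow> 2 * cauchy_transform M z - 1 = F z"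
    by blast
  have eq: "B_transform M z = \<beta> z" if z: "norm z < 1" "z \<noteq> 0" for z
  proof -
    have "2 * cauchy_transform M z - 1 = F z" by (rule G[rule_format, OF z(1)])
    then have "2 * cauchy_transform M z = 2 * (1 / (1 - z * \<beta> z))" by (simp add: F_def)
    then have "cauchy_transform M z = 1 / (1 - z * \<beta> z)" by (subst (asm) mult_cancel_left) simp
    then have "cauchy_transform M z * (1 - z * \<beta> z) = 1" using nz[OF z(1)] by simp
    then have "1 - z * B_transform M z = 1 - z * \<beta> z"
      using arg_cong[OF B_transform_cauchy_transform[OF M z(1)], of "\<lambda>t. t * (1 - z * \<beta> z)"]
      by (simp only: mult.assoc mult_1_left mult_1_right)
    then show ?thesis using z by simp
  qed
  have "B_transform M 0 = \<beta> 0"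
  proof (rule LIM_unique)
    have c: "isCont f 0" if "f holomorphic_on ball 0 1" for f :: "complex \<Rightarrow> complex"
      using continuous_on_interior[OF holomorphic_on_imp_continuous_on[OF that], of 0] by simp
    show "\<beta> \<midarrow>0\<rightarrow> \<beta> 0" using c[OF \<beta>] by (rule isContD)
    have "eventually (\<lambda>w. w \<in> ball 0 1 - {0}) (at (0::complex))"
      by (intro eventually_at_in_open) auto
    then have "eventually (\<lambda>w. B_transform M w = \<beta> w) (at 0)"
      by (rule eventually_mono) (use eq in auto)
    then show "\<beta> \<midarrow>0\<rightarrow> B_transform M 0"
      by (rule Lim_transform_eventually[OF isContD[OF c[OF B_transform_holomorphic[OF M]]]])
  qed
  then have "B_transform M z = \<beta> z" if "z \<in> ball 0 1" for z
    using eq[of z] that by (cases "z = 0") auto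
  then show ?thesis using M by blast
qed

text \<open>A product of two functions into the closed disk is again one, so the description defining
  the convolution is proper.\<close>

lemma bool_mult_conv:
  assumes M: "M \<in> circle_prob" and N: "N \<in> circle_prob"
  shows "bool_mult_conv M N \<in> circle_prob"
    and "z \<in> ball 0 1 \<Longrightarrow> B_transform (bool_mult_conv M N) z = B_transform M z * B_transform N z"
proof -
  let ?P = "\<lambda>L. L \<in> circle_prob \<and> (\<forall>z\<in>ball 0 1. B_transform L z = B_transform M z * B_transform N z)"
  have le: "norm (B_transform M z * B_transform N z) \<le> 1" if "norm z < 1" for z
    using norm_B_transform_le_1[OF M that] norm_B_transform_le_1[OF N that] by (simp add: norm_mult mult_le_one)
  have "\<exists>L\<in>circle_prob. \<forall>z\<in>ball 0 1. B_transform L z = B_transform M z * B_transform N z"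
    by (rule B_transform_surj[OF holomorphic_on_mult[OF B_transform_holomorphic[OF M] B_transform_holomorphic[OF N]] le])
  then obtain L where L: "L \<in> circle_prob" "\<And>z. z \<in> ball 0 1 \<Longrightarrow> B_transform L z = B_transform M z * B_transform N z"
    by blast
  have "?P (bool_mult_conv M N)"
    unfolding bool_mult_conv_def
  proof (rule theI[of ?P L])
    show "?P L" using L by blast
    show "L' = L" if "?P L'" for L'
      by (rule B_transform_inj) (use L that in auto)
  qed
  then show "bool_mult_conv M N \<in> circle_prob"
    "z \<in> ball 0 1 \<Longrightarrow> B_transform (bool_mult_conv M N) z = B_transform M z * B_transform N z" by auto
qed

lemma herglotz_integral:
  assumes M: "circle_measure M" and z: "norm z < 1"
  shows "(\<integral>\<zeta>. (1 + \<zeta> * z) / (1 - \<zeta> * z) \<partial>M) = 2 * cauchy_transform M z - of_real (measure M (space M))"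
proof -
  have int: "integrable M (\<lambda>\<zeta>. 1 / (1 - \<zeta> * z))"
    by (intro circle_integrable M continuous_intros) (use one_minus_mult_nonzero z in auto)
  have int1: "integrable M (\<lambda>\<zeta>. 1 :: complex)"
    by (intro circle_integrable M continuous_on_const)
  have "(\<integral>\<zeta>. (1 + \<zeta> * z) / (1 - \<zeta> * z) \<partial>M) = (\<integral>\<zeta>. 2 * (1 / (1 - \<zeta> * z)) - 1 \<partial>M)"
    by (rule circle_integral_cong[OF M]) (use one_minus_mult_nonzero z in \<open>auto simp: field_simps\<close>)
  also have "\<dots> = 2 * cauchy_transform M z - of_real (measure M (space M))"
    unfolding cauchy_transform_def
    by (subst Bochner_Integration.integral_diff[OF integrable_mult_right[OF int] int1], subst integral_mult_right_zero)
       (simp add: scaleR_conv_of_real)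
  finally show ?thesis .
qed

lemma bool_infdiv:
  assumes \<gamma>: "norm \<gamma> = 1" and \<sigma>: "circle_measure \<sigma>"
  shows "bool_infdiv \<gamma> \<sigma> \<in> circle_prob"
    and "z \<in> ball 0 1 \<Longrightarrow> B_transform (bool_infdiv \<gamma> \<sigma>) z =
           \<gamma> * exp (- (\<integral>\<zeta>. (1 + \<zeta> * z) / (1 - \<zeta> * z) \<partial>\<sigma>))"
proof -
  define \<beta> where "\<beta> z = \<gamma> * exp (- (\<integral>\<zeta>. (1 + \<zeta> * z) / (1 - \<zeta> * z) \<partial>\<sigma>))" for z
  let ?P = "\<lambda>L. L \<in> circle_prob \<and> (\<forall>z\<in>ball 0 1. B_transform L z = \<beta> z)"
  have "(\<lambda>z. \<gamma> * exp (- (2 * cauchy_transform \<sigma> z - of_real (measure \<sigma> (space \<sigma>))))) holomorphic_on ball 0 1"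
    by (intro holomorphic_intros cauchy_transform_holomorphic \<sigma>)
  then have hol: "\<beta> holomorphic_on ball 0 1"
    by (rule holomorphic_transform) (simp add: \<beta>_def herglotz_integral[OF \<sigma>])
  have le: "norm (\<beta> z) \<le> 1" if z: "norm z < 1" for z
  proof -
    have int: "integrable \<sigma> (\<lambda>\<zeta>. (1 + \<zeta> * z) / (1 - \<zeta> * z))"
      by (intro circle_integrable \<sigma> continuous_intros) (use one_minus_mult_nonzero z in auto)
    have "0 \<le> (\<integral>\<zeta>. Re ((1 + \<zeta> * z) / (1 - \<zeta> * z)) \<partial>\<sigma>)"
      using z circle_measureD(3)[OF \<sigma>]
      by (intro integral_nonneg_AE AE_I2 Re_herglotz_kernel_nonneg) (simp add: norm_mult)
    also have "\<dots> = Re (\<integral>\<zeta>. (1 + \<zeta> * z) / (1 - \<zeta> * z) \<partial>\<sigma>)" using int by (rule integral_Re)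
    finally show ?thesis by (simp add: \<beta>_def norm_mult \<gamma>)
  qed
  have "\<exists>L\<in>circle_prob. \<forall>z\<in>ball 0 1. B_transform L z = \<beta> z"
    by (rule B_transform_surj[OF hol le])
  then obtain L where L: "L \<in> circle_prob" "\<And>z. z \<in> ball 0 1 \<Longrightarrow> B_transform L z = \<beta> z"
    by blast
  have "?P (bool_infdiv \<gamma> \<sigma>)"
    unfolding bool_infdiv_def \<beta>_def[symmetric]
  proof (rule theI[of ?P L])
    show "?P L" using L by blast
    show "L' = L" if "?P L'" for L'
      by (rule B_transform_inj) (use L that in auto)
  qed
  then show "bool_infdiv \<gamma> \<sigma> \<in> circle_prob" "z \<in> ball 0 1 \<Longrightarrow> B_transform (bool_infdiv \<gamma> \<sigma>) z =
           \<gamma> * exp (- (\<integral>\<zeta>. (1 + \<zeta> * z) / (1 - \<zeta> * z) \<partial>\<sigma>))" by (auto simp: \<beta>_def)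
qed

lemma return_circle_prob:
  assumes "norm c = 1" shows "return circle_borel c \<in> circle_prob"
  using assms by (auto simp: circle_prob_def circle_borel_def space_restrict_space intro!: prob_space_return)

lemma B_transform_return:
  assumes c: "norm c = 1" and z: "z \<in> ball 0 1"
  shows "B_transform (return circle_borel c) z = c"
proof -
  note R = return_circle_prob[OF c]
  have int: "(\<integral>\<zeta>. f \<zeta> \<partial>return circle_borel c) = f c" if "continuous_on (sphere 0 1) f" for f :: "complex \<Rightarrow> complex"
    using that c by (intro integral_return circle_measurable_continuous[OF refl])
      (auto simp: circle_borel_def space_restrict_space)
  show ?thesis
  proof (cases "z = 0")
    case True
    then show ?thesis using int[of "\<lambda>\<zeta>. \<zeta>"] by (simp add: B_transform_0[OF R] moment_def)
  next
    case False
    have z1: "norm z < 1" using z by simp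
    have "continuous_on (sphere 0 1) (\<lambda>\<zeta>. 1 / (1 - \<zeta> * z))"
      by (intro continuous_intros) (use one_minus_mult_nonzero z1 in auto)
    then have "cauchy_transform (return circle_borel c) z = 1 / (1 - c * z)"
      unfolding cauchy_transform_def by (rule int)
    then have "1 - z * B_transform (return circle_borel c) z = 1 - c * z"
      using B_transform_cauchy_transform[OF R z1] one_minus_mult_nonzero[OF c z1] by (simp add: field_simps)
    then show ?thesis using False by simp
  qed
qed

section \<open>Products close to exponentials\<close>

lemma norm_exp_diff_le:
  fixes y :: complex
  assumes "norm y \<le> 1 / 2"
  shows "norm (1 + y - exp y) \<le> 2 * (norm y)\<^sup>2"
proof -
  have "norm (exp y - (\<Sum>i\<le>1. y ^ i / fact i)) \<le> exp (norm y) * norm y ^ Suc 1 / fact 1"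
    by (rule Taylor_exp_field)
  then have "norm (1 + y - exp y) \<le> exp (norm y) * (norm y)\<^sup>2"
    by (simp add: norm_minus_commute power2_eq_square)
  also have "exp (norm y) \<le> exp (1 / 2)" using assms by simp
  also have "exp (1 / 2 :: real) \<le> 2" by (rule exp_half_le2)
  finally show ?thesis by (simp add: mult_right_mono)
qed

text \<open>All factors lie in the closed unit disk, so a difference of products is at most the sum of the
  differences of the factors. Each of these is \<open>O(\<delta> n * d n i)\<close>: the hypothesis bounds the
  distance of \<open>x\<close> and \<open>y\<close>, and \<open>exp y - 1 - y\<close> is \<open>O(d\<^sup>2)\<close>. The sums of \<open>d\<close> stay bounded.\<close>

lemma prod_minus_exp_tendsto_0:
  fixes x y :: "nat \<Rightarrow> 'i \<Rightarrow> complex" and d :: "nat \<Rightarrow> 'i \<Rightarrow> real"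
  assumes fin: "\<And>n. finite (A n)"
    and \<delta>: "\<delta> \<longlonglongrightarrow> 0" "\<And>n. 0 \<le> \<delta> n" and C: "C \<ge> 0"
    and sum: "eventually (\<lambda>n. (\<Sum>i\<in>A n. d n i) \<le> K) sequentially"
    and small: "\<And>n i. i \<in> A n \<Longrightarrow> 0 \<le> d n i \<and> d n i \<le> \<delta> n"
    and contr: "\<And>n i. i \<in> A n \<Longrightarrow> norm (1 + x n i) \<le> 1 \<and> Re (y n i) \<le> 0"
    and y: "\<And>n i. i \<in> A n \<Longrightarrow> norm (y n i) \<le> C * d n i"
    and xy: "eventually (\<lambda>n. \<forall>i\<in>A n. norm (x n i - y n i) \<le> C * \<delta> n * d n i) sequentially"
  shows "(\<lambda>n. (\<Prod>i\<in>A n. 1 + x n i) - exp (\<Sum>i\<in>A n. y n i)) \<longlonglongrightarrow> 0"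
proof (rule Lim_null_comparison)
  show "(\<lambda>n. (C * \<delta> n + 2 * C\<^sup>2 * \<delta> n) * K) \<longlonglongrightarrow> 0"
    by (rule tendsto_eq_intros \<delta>(1) refl | simp)+
  have "(\<lambda>n. C * \<delta> n) \<longlonglongrightarrow> 0" by (rule tendsto_eq_intros \<delta>(1) refl | simp)+
  then have "eventually (\<lambda>n. C * \<delta> n < 1 / 2) sequentially" by (rule order_tendstoD) simp
  then show "eventually (\<lambda>n. norm ((\<Prod>i\<in>A n. 1 + x n i) - exp (\<Sum>i\<in>A n. y n i))
      \<le> (C * \<delta> n + 2 * C\<^sup>2 * \<delta> n) * K) sequentially"
    using sum xy
  proof eventually_elim
    case (elim n)
    have "norm ((\<Prod>i\<in>A n. 1 + x n i) - (\<Prod>i\<in>A n. exp (y n i))) \<le> (\<Sum>i\<in>A n. norm (1 + x n i - exp (y n i)))"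
      using contr by (intro norm_prod_diff) auto
    also have "\<dots> \<le> (\<Sum>i\<in>A n. (C * \<delta> n + 2 * C\<^sup>2 * \<delta> n) * d n i)"
    proof (rule sum_mono)
      fix i assume i: "i \<in> A n"
      note d = small[OF i]
      have "norm (y n i) \<le> C * \<delta> n" using y[OF i] mult_left_mono[OF conjunct2[OF d] C] by linarith
      then have "norm (y n i) \<le> 1 / 2" using elim by linarith
      from norm_exp_diff_le[OF this]
      have "norm (1 + y n i - exp (y n i)) \<le> 2 * (norm (y n i))\<^sup>2" .
      also have "(norm (y n i))\<^sup>2 \<le> (C * d n i)\<^sup>2" using y[OF i] by (intro power_mono) auto
      also have "(C * d n i)\<^sup>2 = C\<^sup>2 * d n i * d n i" by (simp add: power2_eq_square)
      also have "C\<^sup>2 * d n i * d n i \<le> C\<^sup>2 * \<delta> n * d n i"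
        using d by (intro mult_right_mono mult_left_mono) auto
      finally have 1: "norm (1 + y n i - exp (y n i)) \<le> 2 * C\<^sup>2 * \<delta> n * d n i" by simp
      have "1 + x n i - exp (y n i) = (x n i - y n i) + (1 + y n i - exp (y n i))" by simp
      then have "norm (1 + x n i - exp (y n i)) \<le> norm (x n i - y n i) + norm (1 + y n i - exp (y n i))"
        by (simp only: norm_triangle_ineq)
      also have "norm (x n i - y n i) \<le> C * \<delta> n * d n i" using elim i by blast
      also note 1
      finally show "norm (1 + x n i - exp (y n i)) \<le> (C * \<delta> n + 2 * C\<^sup>2 * \<delta> n) * d n i"
        by (simp add: algebra_simps)
    qed
    also have "\<dots> = (C * \<delta> n + 2 * C\<^sup>2 * \<delta> n) * (\<Sum>i\<in>A n. d n i)" by (simp add: sum_distrib_left)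
    also have "\<dots> \<le> (C * \<delta> n + 2 * C\<^sup>2 * \<delta> n) * K"
      using elim C \<delta>(2)[of n] by (intro mult_left_mono) auto
    finally show ?case by (simp add: exp_sum fin)
  qed
qed

text \<open>From \<open>exp (w n) \<longlonglongrightarrow> 1\<close> alone one only gets \<open>w n\<close> close to multiples of \<open>2 * pi * \<i>\<close>. The coefficient bound
  keeps \<open>w n\<close> within distance \<open>1\<close> of its constant term for small arguments, so that the principal
  logarithm recovers \<open>w n\<close>. Small arguments suffice to control the coefficients.\<close>

lemma exp_powser_coeff_tendsto_0:
  fixes a :: "nat \<Rightarrow> nat \<Rightarrow> complex"
  assumes bound: "\<And>n j. norm (a n j) \<le> C" and a0: "(\<lambda>n. a n 0) \<longlonglongrightarrow> 0"
    and lim: "\<And>x. 0 < x \<Longrightarrow> x < 1 / 2 \<Longrightarrow> (\<lambda>n. exp (\<Sum>j. a n j * of_real x ^ j)) \<longlonglongrightarrow> 1"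
  shows "(\<lambda>n. a n j) \<longlonglongrightarrow> 0"
proof (rule powser_coeff_tendsto_0[OF bound])
  have C: "C \<ge> 0" using bound[of 0 0] norm_ge_zero order_trans by blast
  show "0 < min (1 / 2) (1 / (2 * C + 1))" using C by simp
  fix x :: real assume x: "0 < x" "x < min (1 / 2) (1 / (2 * C + 1))"
  then have x': "x < 1 / 2" "2 * C * x \<le> 1"
    using C by (auto simp: field_simps)
  define w where "w n = (\<Sum>j. a n j * of_real x ^ j)" for n
  have close: "norm (w n - a n 0) \<le> 1" for n
  proof -
    have geo: "summable (\<lambda>i. C * x ^ i)" using x by (intro summable_mult summable_geometric) auto
    have le: "norm (a n i * of_real x ^ i) \<le> C * x ^ i" for i
      using bound[of n i] x by (simp add: norm_mult norm_power mult_right_mono)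
    have sm: "summable (\<lambda>i. a n i * of_real x ^ i)"
      by (rule summable_comparison_test'[OF geo le])
    have "w n - a n 0 = (\<Sum>i. a n (Suc i) * of_real x ^ Suc i)"
      unfolding w_def using suminf_split_head[OF sm] by simp
    also have "norm \<dots> \<le> (\<Sum>i. C * x ^ Suc i)"
      by (rule norm_suminf_le[OF le]) (rule iffD2[OF summable_Suc_iff[of "\<lambda>i. C * x ^ i"] geo])
    also have "(\<Sum>i. C * x ^ Suc i) = C * x * (1 / (1 - x))"
    proof -
      have "(\<lambda>i. C * x * x ^ i) sums (C * x * (1 / (1 - x)))"
        using x by (intro sums_mult geometric_sums) auto
      then show ?thesis by (simp add: sums_iff mult_ac)
    qed
    also have "\<dots> \<le> C * x * 2" using x x' C by (intro mult_left_mono) (auto simp: field_simps)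
    finally show ?thesis using x' by simp
  qed
  have "eventually (\<lambda>n. norm (a n 0) < 1) sequentially"
    by (rule order_tendstoD[OF tendsto_norm_zero[OF a0]]) simp
  then have "eventually (\<lambda>n. Ln (exp (w n)) = w n) sequentially"
  proof eventually_elim
    case (elim n)
    have "norm (w n) \<le> norm (w n - a n 0) + norm (a n 0)"
      by (metis diff_add_cancel norm_triangle_ineq)
    then have "\<bar>Im (w n)\<bar> < 2" using close[of n] elim abs_Im_le_cmod[of "w n"] by linarith
    then show ?case using pi_ge_two by (intro Ln_exp) auto
  qed
  moreover have "(\<lambda>n. Ln (exp (w n))) \<longlonglongrightarrow> Ln 1"
    using lim[OF x(1) x'(1)] unfolding w_def[symmetric]
    by (rule isCont_tendsto_compose[OF continuous_at_Ln, rotated]) auto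
  ultimately show "(\<lambda>n. \<Sum>j. a n j * of_real x ^ j) \<longlonglongrightarrow> 0"
    unfolding w_def[symmetric] by (simp add: tendsto_cong)
qed

section \<open>Convolution on the circle\<close>

lemma circle_conv:
  assumes M: "M \<in> circle_prob" and N: "N \<in> circle_prob"
  shows "circle_conv M N \<in> circle_prob"
    and "moment (circle_conv M N) j = moment M j * moment N j"
proof -
  note M' = circle_prob_imp_circle_measure[OF M] and N' = circle_prob_imp_circle_measure[OF N]
  interpret M: prob_space M using M by (simp add: circle_prob_def)
  interpret N: prob_space N using N by (simp add: circle_prob_def)
  interpret P: pair_prob_space M N ..
  have idm: "(\<lambda>\<zeta>. \<zeta>) \<in> borel_measurable L" if "circle_measure L" for L
    by (intro circle_measurable_continuous[OF circle_measureD(2)[OF that]] continuous_intros)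
  have meas: "(\<lambda>(x, y). x * y) \<in> measurable (M \<Otimes>\<^sub>M N) circle_borel"
    unfolding circle_borel_def
  proof (rule measurable_restrict_space2)
    show "(\<lambda>(x, y). x * y) \<in> space (M \<Otimes>\<^sub>M N) \<rightarrow> sphere 0 1"
      using circle_measureD(3)[OF M'] circle_measureD(3)[OF N'] by (auto simp: space_pair_measure norm_mult)
    show "(\<lambda>(x, y). x * y) \<in> borel_measurable (M \<Otimes>\<^sub>M N)"
      unfolding case_prod_beta
      by (rule borel_measurable_times[OF measurable_compose[OF measurable_fst idm[OF M']]
            measurable_compose[OF measurable_snd idm[OF N']]])
  qed
  show "circle_conv M N \<in> circle_prob"
    by (simp add: circle_conv_def circle_prob_def P.prob_space_distr[OF meas])
  have fm: "(\<lambda>\<zeta>. \<zeta> ^ j) \<in> borel_measurable L" if "circle_measure L" for L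
    by (intro circle_measurable_continuous[OF circle_measureD(2)[OF that]] continuous_intros)
  have int: "integrable (M \<Otimes>\<^sub>M N) (\<lambda>(x, y). x ^ j * y ^ j)"
  proof (rule P.integrable_const_bound[where B = 1])
    show "AE p in M \<Otimes>\<^sub>M N. norm (case p of (x, y) \<Rightarrow> x ^ j * y ^ j) \<le> 1"
      using circle_measureD(3)[OF M'] circle_measureD(3)[OF N']
      by (intro AE_I2) (auto simp: space_pair_measure norm_mult norm_power)
    show "(\<lambda>(x, y). x ^ j * y ^ j) \<in> borel_measurable (M \<Otimes>\<^sub>M N)"
      unfolding case_prod_beta
      by (rule borel_measurable_times[OF measurable_compose[OF measurable_fst fm[OF M']]
            measurable_compose[OF measurable_snd fm[OF N']]])
  qed
  have "moment (circle_conv M N) j = (\<integral>p. (case p of (x, y) \<Rightarrow> x * y) ^ j \<partial>(M \<Otimes>\<^sub>M N))"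
    unfolding moment_def circle_conv_def
    by (rule integral_distr[OF meas]) (rule circle_measurable_continuous[OF refl], intro continuous_intros)
  also have "\<dots> = (\<integral>p. (case p of (x, y) \<Rightarrow> x ^ j * y ^ j) \<partial>(M \<Otimes>\<^sub>M N))"
    by (simp add: case_prod_beta power_mult_distrib)
  also have "\<dots> = (\<integral>x. (\<integral>y. x ^ j * y ^ j \<partial>N) \<partial>M)"
    using P.integral_fst[OF int] by simp
  also have "\<dots> = moment M j * moment N j"
    by (simp add: moment_def)
  finally show "moment (circle_conv M N) j = moment M j * moment N j" .
qed

lemma conv_row_Suc: "conv_row conv c M (Suc m) = conv (conv_row conv c M m) (M (Suc m))"
  by (simp add: conv_row_def)

lemma conv_row_0: "conv_row conv c M 0 = return circle_borel c"
  by (simp add: conv_row_def)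

lemma moment_return:
  assumes "norm c = 1" shows "moment (return circle_borel c) j = c ^ j"
  unfolding moment_def using assms
  by (intro integral_return circle_measurable_continuous[OF refl] continuous_intros)
      (auto simp: circle_borel_def space_restrict_space)

lemma circle_conv_row:
  assumes c: "norm c = 1" and M: "\<And>i. i \<in> {1..m} \<Longrightarrow> M i \<in> circle_prob"
  shows "conv_row circle_conv c M m \<in> circle_prob \<and>
         moment (conv_row circle_conv c M m) j = c ^ j * (\<Prod>i\<in>{1..m}. moment (M i) j)"
  using M
proof (induction m)
  case 0
  then show ?case using return_circle_prob[OF c] moment_return[OF c] by (simp add: conv_row_0)
next
  case (Suc m)
  have IH: "conv_row circle_conv c M m \<in> circle_prob"
      "moment (conv_row circle_conv c M m) j = c ^ j * (\<Prod>i\<in>{1..m}. moment (M i) j)"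
    using Suc.IH Suc.prems by auto
  have S: "M (Suc m) \<in> circle_prob" using Suc.prems by simp
  show ?case using circle_conv[OF IH(1) S] IH(2) by (simp add: conv_row_Suc mult_ac)
qed

lemma bool_conv_row:
  assumes c: "norm c = 1" and M: "\<And>i. i \<in> {1..m} \<Longrightarrow> M i \<in> circle_prob"
  shows "conv_row bool_mult_conv c M m \<in> circle_prob \<and>
         (\<forall>z\<in>ball 0 1. B_transform (conv_row bool_mult_conv c M m) z = c * (\<Prod>i\<in>{1..m}. B_transform (M i) z))"
  using M
proof (induction m)
  case 0
  then show ?case using return_circle_prob[OF c] B_transform_return[OF c] by (simp add: conv_row_0)
next
  case (Suc m)
  have IH: "conv_row bool_mult_conv c M m \<in> circle_prob"
      "\<And>z. z \<in> ball 0 1 \<Longrightarrow> B_transform (conv_row bool_mult_conv c M m) z = c * (\<Prod>i\<in>{1..m}. B_transform (M i) z)"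
    using Suc.IH Suc.prems by auto
  have S: "M (Suc m) \<in> circle_prob" using Suc.prems by simp
  show ?case using bool_mult_conv[OF IH(1) S] IH(2) by (simp add: conv_row_Suc mult_ac)
qed

lemma B_transform_tendsto:
  assumes w: "circle_weak_conv M N" and M: "\<And>n. M n \<in> circle_prob" and N: "N \<in> circle_prob"
    and z: "z \<in> ball 0 1"
  shows "(\<lambda>n. B_transform (M n) z) \<longlonglongrightarrow> B_transform N z"
proof (cases "z = 0")
  case True
  show ?thesis
    unfolding True B_transform_0[OF M] B_transform_0[OF N]
    by (rule moment_tendsto_of_weak_conv[OF w]) (auto intro: circle_prob_imp_circle_measure M N)
next
  case False
  have z1: "norm z < 1" using z by simp
  have nz: "cauchy_transform L z \<noteq> 0" if "L \<in> circle_prob" for L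
    using Re_cauchy_transform[OF that z1] by auto
  have B: "B_transform L z = (1 - 1 / cauchy_transform L z) / z" if "L \<in> circle_prob" for L
  proof -
    have "1 - z * B_transform L z = 1 / cauchy_transform L z"
      using B_transform_cauchy_transform[OF that z1] nz[OF that] by (simp add: field_simps)
    then have "z * B_transform L z = 1 - 1 / cauchy_transform L z" by (simp add: algebra_simps)
    then show ?thesis using False by (simp add: field_simps)
  qed
  have "continuous_on (sphere 0 1) (\<lambda>\<zeta>. 1 / (1 - \<zeta> * z))"
    by (intro continuous_intros) (use one_minus_mult_nonzero z1 in auto)
  then have "(\<lambda>n. cauchy_transform (M n) z) \<longlonglongrightarrow> cauchy_transform N z"
    unfolding cauchy_transform_def
    by (intro weak_conv_complex[OF w]) (auto intro: circle_prob_imp_circle_measure M N)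
  then show ?thesis
    unfolding B[OF M] B[OF N] using nz[OF N] False by (intro tendsto_intros) auto
qed

section \<open>Rotations and the weight 1 - Re z\<close>

definition rotate :: "complex \<Rightarrow> complex measure \<Rightarrow> complex measure" where
  "rotate \<omega> M = distr M circle_borel (\<lambda>\<zeta>. \<zeta> * \<omega>)"

lemma
  assumes M: "M \<in> circle_prob" and \<omega>: "norm \<omega> = 1"
  shows rotate_circle_prob: "rotate \<omega> M \<in> circle_prob"
    and moment_rotate: "moment (rotate \<omega> M) j = \<omega> ^ j * moment M j"
    and cauchy_transform_rotate: "norm z < 1 \<Longrightarrow> cauchy_transform (rotate \<omega> M) z = cauchy_transform M (\<omega> * z)"
proof -
  note M' = circle_prob_imp_circle_measure[OF M]
  have meas: "(\<lambda>\<zeta>. \<zeta> * \<omega>) \<in> measurable M circle_borel"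
    unfolding circle_borel_def
  proof (rule measurable_restrict_space2)
    show "(\<lambda>\<zeta>. \<zeta> * \<omega>) \<in> space M \<rightarrow> sphere 0 1"
      using circle_measureD(3)[OF M'] \<omega> by (auto simp: norm_mult)
    show "(\<lambda>\<zeta>. \<zeta> * \<omega>) \<in> borel_measurable M"
      by (intro circle_measurable_continuous[OF circle_measureD(2)[OF M']] continuous_intros)
  qed
  show "rotate \<omega> M \<in> circle_prob"
    using M by (auto simp: rotate_def circle_prob_def intro!: prob_space.prob_space_distr[OF _ meas])
  have int: "(\<integral>\<zeta>. f \<zeta> \<partial>rotate \<omega> M) = (\<integral>\<zeta>. f (\<zeta> * \<omega>) \<partial>M)" if "continuous_on (sphere 0 1) f" for f :: "complex \<Rightarrow> complex"
    unfolding rotate_def by (rule integral_distr[OF meas circle_measurable_continuous[OF refl that]])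
  have "moment (rotate \<omega> M) j = (\<integral>\<zeta>. (\<zeta> * \<omega>) ^ j \<partial>M)"
    unfolding moment_def by (intro int continuous_intros)
  then show "moment (rotate \<omega> M) j = \<omega> ^ j * moment M j"
    by (simp add: moment_def power_mult_distrib mult.commute)
  assume z: "norm z < 1"
  have "continuous_on (sphere 0 1) (\<lambda>\<zeta>. 1 / (1 - \<zeta> * z))"
    by (intro continuous_intros) (use one_minus_mult_nonzero z in auto)
  from int[OF this] show "cauchy_transform (rotate \<omega> M) z = cauchy_transform M (\<omega> * z)"
    by (simp add: cauchy_transform_def mult.assoc)
qed

text \<open>Rotation acts on the Cauchy transform by rotating its argument, and the relation
  \<open>(1 - z * B) * G = 1\<close> transfers this to \<open>B\<close> with an additional factor.\<close>

lemma B_transform_rotate: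
  assumes M: "M \<in> circle_prob" and \<omega>: "norm \<omega> = 1" and z: "norm z < 1"
  shows "B_transform (rotate \<omega> M) z = \<omega> * B_transform M (\<omega> * z)"
proof (cases "z = 0")
  case True
  then show ?thesis
    by (simp add: B_transform_0 moment_rotate M \<omega> rotate_circle_prob)
next
  case False
  have z': "norm (\<omega> * z) < 1" using z \<omega> by (simp add: norm_mult)
  have nz: "cauchy_transform M (\<omega> * z) \<noteq> 0" using Re_cauchy_transform[OF M z'] by auto
  have "(1 - z * B_transform (rotate \<omega> M) z) * cauchy_transform M (\<omega> * z)
      = (1 - \<omega> * z * B_transform M (\<omega> * z)) * cauchy_transform M (\<omega> * z)"
    using B_transform_cauchy_transform[OF M z'] B_transform_cauchy_transform[OF rotate_circle_prob[OF M \<omega>] z]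
    by (simp add: cauchy_transform_rotate[OF M \<omega> z])
  then have "z * B_transform (rotate \<omega> M) z = z * (\<omega> * B_transform M (\<omega> * z))"
    using nz by (simp add: mult_ac)
  then show ?thesis using False by simp
qed

text \<open>The weight \<open>1 - Re \<zeta>\<close> vanishes to second order at \<open>\<zeta> = 1\<close>. For a centred measure the weighted measure
  carries both the deviation of the moments from \<open>1\<close> and that of the \<open>B\<close>-transform.\<close>

definition tilt :: "complex measure \<Rightarrow> complex measure" where
  "tilt M = density M (\<lambda>\<zeta>. ennreal (1 - Re \<zeta>))"

lemma Re_le_1_circle: "norm \<zeta> = 1 \<Longrightarrow> Re \<zeta> \<le> 1"
  using complex_Re_le_cmod[of \<zeta>] by simp

lemma
  assumes M: "M \<in> circle_prob"
  shows tilt_circle_measure: "circle_measure (tilt M)"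
    and measure_tilt: "measure (tilt M) (space (tilt M)) = 1 - Re (moment M 1)"
    and integral_tilt: "continuous_on (sphere 0 1) f \<Longrightarrow>
      (\<integral>\<zeta>. f \<zeta> \<partial>tilt M) = (\<integral>\<zeta>. of_real (1 - Re \<zeta>) * (f \<zeta> :: complex) \<partial>M)"
proof -
  note M' = circle_prob_imp_circle_measure[OF M]
  have w: "(\<lambda>\<zeta>. 1 - Re \<zeta>) \<in> borel_measurable M"
    by (intro circle_measurable_continuous[OF circle_measureD(2)[OF M']] continuous_intros)
  have nn: "AE \<zeta> in M. 0 \<le> 1 - Re \<zeta>"
    using circle_measureD(3)[OF M'] Re_le_1_circle by (intro AE_I2) auto
  have sets: "sets (tilt M) = sets circle_borel"
    using circle_measureD(2)[OF M'] by (simp add: tilt_def)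
  have iw: "integrable M (\<lambda>\<zeta>. 1 - Re \<zeta>)"
    by (intro circle_integrable M' continuous_intros)
  have em: "emeasure (tilt M) (space (tilt M)) = ennreal (1 - Re (moment M 1))"
  proof -
    have i1: "integrable M (\<lambda>\<zeta>. \<zeta>)" "integrable M (\<lambda>\<zeta>. 1::real)"
      by (intro circle_integrable M' continuous_intros)+
    have "emeasure (tilt M) (space (tilt M)) = (\<integral>\<^sup>+\<zeta>. ennreal (1 - Re \<zeta>) \<partial>M)"
      unfolding tilt_def using w by (subst emeasure_density) (auto intro!: nn_integral_cong)
    also have "\<dots> = ennreal (\<integral>\<zeta>. 1 - Re \<zeta> \<partial>M)"
      by (rule nn_integral_eq_integral[OF iw nn])
    also have "(\<integral>\<zeta>. 1 - Re \<zeta> \<partial>M) = 1 - Re (moment M 1)"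
      using i1 by (simp add: moment_def circle_prob_measure_space[OF M])
    finally show ?thesis .
  qed
  have "finite_measure (tilt M)"
    by (rule finite_measureI) (simp add: em)
  then show "circle_measure (tilt M)" using sets by (simp add: circle_measure_def)
  have "norm (moment M 1) \<le> 1" using norm_moment_le[OF M', of 1] by (simp add: circle_prob_measure_space[OF M])
  then have "Re (moment M 1) \<le> 1" using complex_Re_le_cmod order_trans by blast
  then show "measure (tilt M) (space (tilt M)) = 1 - Re (moment M 1)"
    using em by (simp add: measure_def)
  assume f: "continuous_on (sphere 0 1) f"
  have "(\<integral>\<zeta>. f \<zeta> \<partial>tilt M) = (\<integral>\<zeta>. (1 - Re \<zeta>) *\<^sub>R f \<zeta> \<partial>M)"
    unfolding tilt_def
    by (rule integral_density[OF circle_measurable_continuous[OF circle_measureD(2)[OF M'] f] w nn])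
  then show "(\<integral>\<zeta>. f \<zeta> \<partial>tilt M) = (\<integral>\<zeta>. of_real (1 - Re \<zeta>) * f \<zeta> \<partial>M)"
    by (simp only: scaleR_conv_of_real)
qed

definition herglotz :: "complex measure \<Rightarrow> complex \<Rightarrow> complex" where
  "herglotz M z = (\<integral>\<zeta>. (1 + \<zeta> * z) / (1 - \<zeta> * z) \<partial>M)"

lemma continuous_herglotz_kernel:
  fixes z :: complex
  shows "norm z < 1 \<Longrightarrow> continuous_on (sphere 0 1) (\<lambda>\<zeta>. (1 + \<zeta> * z) / (1 - \<zeta> * z))"
  by (intro continuous_intros) (use one_minus_mult_nonzero in auto)

lemma Re_herglotz_nonneg:
  assumes M: "circle_measure M" and z: "norm z < 1"
  shows "Re (herglotz M z) \<ge> 0"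
proof -
  have int: "integrable M (\<lambda>\<zeta>. (1 + \<zeta> * z) / (1 - \<zeta> * z))"
    by (intro circle_integrable M continuous_herglotz_kernel z)
  have "0 \<le> (\<integral>\<zeta>. Re ((1 + \<zeta> * z) / (1 - \<zeta> * z)) \<partial>M)"
    using z circle_measureD(3)[OF M]
    by (intro integral_nonneg_AE AE_I2 Re_herglotz_kernel_nonneg) (simp add: norm_mult)
  also have "\<dots> = Re (herglotz M z)" using int unfolding herglotz_def by (rule integral_Re)
  finally show ?thesis .
qed

lemma herglotz_sums:
  assumes M: "circle_measure M" and z: "norm z < 1"
  shows "(\<lambda>j. (if j = 0 then 1 else 2) * moment M j * z ^ j) sums herglotz M z"
proof -
  have "(\<lambda>j. 2 * (moment M j * z ^ j) - (if j = 0 then moment M 0 else 0)) sums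
      (2 * cauchy_transform M z - moment M 0)"
    using sums_If_finite_set[of "{0::nat}" "\<lambda>_. moment M 0"]
    by (intro sums_diff sums_mult cauchy_transform_sums M z) simp
  moreover have "(\<lambda>j. 2 * (moment M j * z ^ j) - (if j = 0 then moment M 0 else 0))
      = (\<lambda>j. (if j = 0 then 1 else 2) * moment M j * z ^ j)" by (auto simp: fun_eq_iff)
  ultimately show ?thesis by (simp add: herglotz_def herglotz_integral[OF M z] moment_0[OF M])
qed

lemma norm_herglotz_le:
  assumes M: "circle_measure M" and z: "norm z \<le> 1 / 2"
  shows "norm (herglotz M z) \<le> 3 * measure M (space M)"
  unfolding herglotz_def
proof (rule circle_norm_integral_le[OF M])
  fix \<zeta> :: complex assume \<zeta>: "norm \<zeta> = 1"
  have "norm (1 + \<zeta> * z) \<le> 1 + norm z" using norm_triangle_ineq[of 1 "\<zeta> * z"] \<zeta> by (simp add: norm_mult)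
  then have "norm (1 + \<zeta> * z) \<le> 3 * (1 / 2)" using z by simp
  also have "\<dots> \<le> 3 * norm (1 - \<zeta> * z)" using one_minus_norm_le[OF \<zeta>, of z] z by simp
  finally show "norm ((1 + \<zeta> * z) / (1 - \<zeta> * z)) \<le> 3"
    using one_minus_mult_nonzero[OF \<zeta>, of z] z by (simp add: norm_divide field_simps)
qed

text \<open>Centring rotates the argument of the \<open>B\<close>-transform by a factor close to \<open>1\<close>; this is the cost of
  undoing that rotation.\<close>

lemma norm_herglotz_diff_le:
  assumes M: "circle_measure M" and z: "norm z \<le> 1 / 2" and \<omega>: "norm \<omega> = 1"
  shows "norm (herglotz M (\<omega> * z) - herglotz M z) \<le> 4 * norm (\<omega> - 1) * measure M (space M)"
proof -
  have z': "norm (\<omega> * z) \<le> 1 / 2" using z \<omega> by (simp add: norm_mult)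
  have lt: "norm z < 1" "norm (\<omega> * z) < 1" using z z' by auto
  have "herglotz M (\<omega> * z) - herglotz M z =
     (\<integral>\<zeta>. (1 + \<zeta> * (\<omega> * z)) / (1 - \<zeta> * (\<omega> * z)) - (1 + \<zeta> * z) / (1 - \<zeta> * z) \<partial>M)"
    unfolding herglotz_def
    by (rule Bochner_Integration.integral_diff[symmetric])
       (intro circle_integrable M continuous_herglotz_kernel lt)+
  also have "norm \<dots> \<le> 4 * norm (\<omega> - 1) * measure M (space M)"
  proof (rule circle_norm_integral_le[OF M])
    fix \<zeta> :: complex assume \<zeta>: "norm \<zeta> = 1"
    let ?a = "1 - \<zeta> * (\<omega> * z)" and ?b = "1 - \<zeta> * z"
    have nz: "?a \<noteq> 0" "?b \<noteq> 0" using one_minus_mult_nonzero \<zeta> lt by auto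
    \<comment> \<open>the difference quotient of \<open>w \<mapsto> (1 + w) / (1 - w)\<close>\<close>
    have e: "(1 + \<zeta> * (\<omega> * z)) / ?a - (1 + \<zeta> * z) / ?b = 2 * \<zeta> * z * (\<omega> - 1) / (?a * ?b)"
      using nz by (simp add: divide_simps) (simp add: algebra_simps)
    have "1 / 2 \<le> norm ?a" "1 / 2 \<le> norm ?b"
      using one_minus_norm_le[OF \<zeta>, of z] one_minus_norm_le[OF \<zeta>, of "\<omega> * z"] z z' by linarith+
    then have "(1 / 2) * (1 / 2) \<le> norm ?a * norm ?b" by (intro mult_mono) auto
    then have "norm (2 * \<zeta> * z * (\<omega> - 1)) / norm (?a * ?b) \<le> norm (2 * \<zeta> * z * (\<omega> - 1)) / (1 / 4)"
      using nz by (intro divide_left_mono) (auto simp: norm_mult)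
    also have "\<dots> = 8 * norm z * norm (\<omega> - 1)" using \<zeta> by (simp add: norm_mult)
    also have "\<dots> \<le> 8 * (1 / 2) * norm (\<omega> - 1)" using z by (intro mult_right_mono) auto
    finally show "norm ((1 + \<zeta> * (\<omega> * z)) / ?a - (1 + \<zeta> * z) / ?b) \<le> 4 * norm (\<omega> - 1)"
      unfolding e norm_divide by simp
  qed
  finally show ?thesis .
qed

section \<open>Centred measures\<close>

text \<open>The pointwise identity \<open>(1 - z)(\<zeta> - 1)/(1 - \<zeta>z) = \<i> * Im \<zeta> - (1 - Re \<zeta>)(1 + \<zeta>z)/(1 - \<zeta>z)\<close> on the circle is
  integrated. Its first term drops out because the mean is real, which gives
  \<open>z * N = (1 - z) * ((1 - z) * G - 1)\<close>; together with \<open>(1 - z * B) * G = 1\<close> this is the claim.\<close>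

lemma centred_B_transform:
  assumes M: "M \<in> circle_prob" and m: "Im (moment M 1) = 0" and z: "norm z < 1" "z \<noteq> 0"
  defines "N \<equiv> - herglotz (tilt M) z"
  shows "(B_transform M z - 1) * (1 + z * N / (1 - z)) = N"
proof -
  note M' = circle_prob_imp_circle_measure[OF M]
  define G where "G = cauchy_transform M z"
  have nz1: "1 - z \<noteq> 0" using z by auto
  have iG: "integrable M (\<lambda>\<zeta>. 1 / (1 - \<zeta> * z))"
    by (intro circle_integrable M' continuous_intros) (use one_minus_mult_nonzero z in auto)
  have i1: "integrable M (\<lambda>\<zeta>. 1 :: complex)" by (intro circle_integrable M' continuous_intros)
  have iN: "integrable M (\<lambda>\<zeta>. of_real (1 - Re \<zeta>) * ((1 + \<zeta> * z) / (1 - \<zeta> * z)))"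
    by (intro circle_integrable M' continuous_on_mult continuous_herglotz_kernel z continuous_intros)
  have iI: "integrable M (\<lambda>\<zeta>. \<i> * of_real (Im \<zeta>))" by (intro circle_integrable M' continuous_intros)
  have I0: "(\<integral>\<zeta>. \<i> * of_real (Im \<zeta>) \<partial>M) = 0"
  proof -
    have "integrable M (\<lambda>\<zeta>. \<zeta>)" by (intro circle_integrable M' continuous_intros)
    then have "(\<integral>\<zeta>. Im \<zeta> \<partial>M) = 0" using m by (simp add: moment_def)
    then show ?thesis by simp
  qed
  have N: "N = - (\<integral>\<zeta>. of_real (1 - Re \<zeta>) * ((1 + \<zeta> * z) / (1 - \<zeta> * z)) \<partial>M)"
    unfolding N_def herglotz_def using integral_tilt[OF M continuous_herglotz_kernel[OF z(1)]] by simp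
  have "z * N = (\<integral>\<zeta>. z * (\<i> * of_real (Im \<zeta>) - of_real (1 - Re \<zeta>) * ((1 + \<zeta> * z) / (1 - \<zeta> * z))) \<partial>M)"
    using iI iN I0 unfolding N integral_mult_right_zero by (subst Bochner_Integration.integral_diff) simp_all
  also have "\<dots> = (\<integral>\<zeta>. (1 - z) * ((1 - z) * (1 / (1 - \<zeta> * z)) - 1) \<partial>M)"
  proof (rule circle_integral_cong[OF M'])
    fix \<zeta> :: complex assume \<zeta>: "norm \<zeta> = 1"
    have nz: "1 - \<zeta> * z \<noteq> 0" using one_minus_mult_nonzero[OF \<zeta> z(1)] .
    have inv: "\<zeta> * cnj \<zeta> = 1" using \<zeta> by (simp add: complex_norm_square[symmetric])
    have Re: "of_real (1 - Re \<zeta>) = (2 - \<zeta> - cnj \<zeta>) / 2" and Im: "\<i> * of_real (Im \<zeta>) = (\<zeta> - cnj \<zeta>) / 2"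
      by (simp_all add: complex_eq_iff)
    have "(\<zeta> - cnj \<zeta>) / 2 * (1 - \<zeta> * z) - (2 - \<zeta> - cnj \<zeta>) / 2 * (1 + \<zeta> * z) = (1 - z) * (\<zeta> - 1)"
    proof -
      have "(\<zeta> - cnj \<zeta>) / 2 * (1 - \<zeta> * z) - (2 - \<zeta> - cnj \<zeta>) / 2 * (1 + \<zeta> * z)
        = \<zeta> - 1 - \<zeta> * z + (\<zeta> * cnj \<zeta>) * z" by (simp add: field_simps)
      then show ?thesis by (simp add: inv algebra_simps)
    qed
    moreover have "a - b * (c / D) = (a * D - b * c) / D" if "D \<noteq> 0" for a b c D :: complex
      using that by (simp add: diff_divide_distrib)
    ultimately have "(\<zeta> - cnj \<zeta>) / 2 - (2 - \<zeta> - cnj \<zeta>) / 2 * ((1 + \<zeta> * z) / (1 - \<zeta> * z)) = (1 - z) * (\<zeta> - 1) / (1 - \<zeta> * z)"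
      using nz by metis
    then show "z * (\<i> * of_real (Im \<zeta>) - of_real (1 - Re \<zeta>) * ((1 + \<zeta> * z) / (1 - \<zeta> * z)))
        = (1 - z) * ((1 - z) * (1 / (1 - \<zeta> * z)) - 1)"
      unfolding Re Im using nz by (simp only:) (simp add: field_simps)
  qed
  also have "\<dots> = (1 - z) * ((1 - z) * G - 1)"
    unfolding integral_mult_right_zero G_def cauchy_transform_def
    by (subst Bochner_Integration.integral_diff[OF integrable_mult_right[OF iG] i1], subst integral_mult_right_zero)
       (simp add: circle_prob_measure_space[OF M])
  finally have zN: "z * N = (1 - z) * ((1 - z) * G - 1)" .
  have BG: "(1 - z * B_transform M z) * G = 1" using B_transform_cauchy_transform[OF M z(1)] by (simp add: G_def)
  have D: "1 + z * N / (1 - z) = (1 - z) * G" using nz1 by (simp add: zN)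
  have "z * ((B_transform M z - 1) * ((1 - z) * G)) = (1 - z) * (G - (1 - z * B_transform M z) * G - z * G)"
    by (simp add: algebra_simps)
  also have "\<dots> = z * N" unfolding BG zN by (simp add: algebra_simps)
  finally show ?thesis unfolding D using z(2) by simp
qed

text \<open>The factor multiplying \<open>B - 1\<close> in the exact formula is \<open>1 + q\<close> with \<open>|q| \<le> 3 * d\<close>, where \<open>d\<close> is the mass of
  the weighted measure; also \<open>|N| \<le> 3 * d\<close>. As \<open>|1 + q| \<ge> 1/2\<close>, the error \<open>|N * q| / |1 + q|\<close> is
  at most \<open>18 * d\<^sup>2\<close>.\<close>

lemma centred_B_transform_approx:
  assumes M: "M \<in> circle_prob" and m: "Im (moment M 1) = 0" and z: "norm z \<le> 1 / 2" "z \<noteq> 0"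
    and d: "1 - Re (moment M 1) \<le> 1 / 6"
  shows "norm (B_transform M z - 1 + herglotz (tilt M) z) \<le> 18 * (1 - Re (moment M 1))\<^sup>2"
proof -
  define d' where "d' = 1 - Re (moment M 1)"
  define N where "N = - herglotz (tilt M) z"
  define q where "q = z * N / (1 - z)"
  have N: "norm N \<le> 3 * d'"
    using norm_herglotz_le[OF tilt_circle_measure[OF M] z(1)] by (simp add: N_def d'_def measure_tilt[OF M])
  have "norm z \<le> norm (1 - z)" using one_minus_norm_le[of 1 z] z(1) by simp
  then have "norm q \<le> norm N"
    using z by (auto simp: q_def norm_mult norm_divide divide_le_eq mult.commute intro: mult_left_mono)
  then have q: "norm q \<le> 3 * d'" "norm q \<le> 1 / 2" using N d by (auto simp: d'_def)
  have D: "1 / 2 \<le> norm (1 + q)" using norm_diff_ineq[of 1 q] q by simp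
  then have nz: "1 + q \<noteq> 0" by auto
  have "(B_transform M z - 1) * (1 + q) = N"
    unfolding q_def N_def by (rule centred_B_transform[OF M m]) (use z in auto)
  then have "(B_transform M z - 1 - N) * (1 + q) = - (N * q)" by (simp add: algebra_simps)
  then have "norm (B_transform M z - 1 - N) * norm (1 + q) = norm N * norm q"
    by (metis norm_minus_cancel norm_mult)
  moreover have "norm (B_transform M z - 1 - N) * (1 / 2) \<le> norm (B_transform M z - 1 - N) * norm (1 + q)"
    using D by (intro mult_left_mono) auto
  moreover have "norm N * norm q \<le> (3 * d') * (3 * d')" using N q(1) order_trans[OF norm_ge_zero q(1)] by (intro mult_mono) auto
  ultimately have "norm (B_transform M z - 1 - N) \<le> 18 * d'\<^sup>2" by (simp add: power2_eq_square)
  then show ?thesis by (simp add: N_def d'_def)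
qed

section \<open>The Levy kernel\<close>

text \<open>The Levy kernel of index \<open>p\<close> as a polynomial. The recursion comes from
  \<open>\<zeta> ^ (p + 2) - 2 * \<zeta> ^ (p + 1) + \<zeta> ^ p = - 2 * (1 - Re \<zeta>) * \<zeta> ^ (p + 1)\<close> on the circle. It shows the
  continuity of the kernel at \<open>1\<close> and expresses its integrals by moments.\<close>

fun levy_poly :: "nat \<Rightarrow> complex \<Rightarrow> complex" where
  "levy_poly 0 \<zeta> = 0"
| "levy_poly (Suc 0) \<zeta> = -1"
| "levy_poly (Suc (Suc p)) \<zeta> = 2 * levy_poly (Suc p) \<zeta> - levy_poly p \<zeta> - 2 * \<zeta> ^ Suc p"

lemma levy_poly_mult:
  assumes \<zeta>: "norm \<zeta> = 1"
  shows "of_real (1 - Re \<zeta>) * levy_poly p \<zeta> = \<zeta> ^ p - 1 - \<i> * of_nat p * of_real (Im \<zeta>)"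
proof (induction p rule: induct_nat_012)
  case 1
  then show ?case by (simp add: complex_eq_iff)
next
  case (ge2 p)
  have inv: "\<zeta> * cnj \<zeta> = 1" using \<zeta> by (simp add: complex_norm_square[symmetric])
  have Re: "2 * of_real (1 - Re \<zeta>) = 2 - \<zeta> - cnj \<zeta>" by (simp add: complex_eq_iff)
  have "2 * of_real (1 - Re \<zeta>) * \<zeta> ^ Suc p = 2 * \<zeta> ^ Suc p - \<zeta> * \<zeta> ^ Suc p - (\<zeta> * cnj \<zeta>) * \<zeta> ^ p"
    unfolding Re by (simp add: algebra_simps)
  then have *: "2 * of_real (1 - Re \<zeta>) * \<zeta> ^ Suc p = 2 * \<zeta> ^ Suc p - \<zeta> ^ Suc (Suc p) - \<zeta> ^ p"
    unfolding inv by simp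
  have "of_real (1 - Re \<zeta>) * levy_poly (Suc (Suc p)) \<zeta> = 2 * (of_real (1 - Re \<zeta>) * levy_poly (Suc p) \<zeta>)
     - of_real (1 - Re \<zeta>) * levy_poly p \<zeta> - 2 * of_real (1 - Re \<zeta>) * \<zeta> ^ Suc p"
    by (simp add: algebra_simps)
  also have "\<dots> = \<zeta> ^ Suc (Suc p) - 1 - \<i> * of_nat (Suc (Suc p)) * of_real (Im \<zeta>)"
    unfolding ge2.IH * by (simp add: algebra_simps)
  finally show ?case .
qed simp

lemma levy_poly_1: "levy_poly p 1 = - (of_nat p)\<^sup>2"
proof (induction p rule: induct_nat_012)
  case (ge2 p)
  show ?case
    by (simp only: levy_poly.simps ge2.IH) (simp add: power2_eq_square algebra_simps)
qed simp_all

lemma levy_kernel_eq_levy_poly: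
  assumes "norm \<zeta> = 1" shows "levy_kernel (int p) \<zeta> = levy_poly p \<zeta>"
proof (cases "\<zeta> = 1")
  case True
  then show ?thesis by (simp add: levy_kernel_def levy_poly_1)
next
  case False
  have "Re \<zeta> \<noteq> 1"
  proof
    assume "Re \<zeta> = 1"
    moreover from this have "Im \<zeta> = 0" using assms cmod_power2[of \<zeta>] by simp
    ultimately show False using False by (simp add: complex_eq_iff)
  qed
  then have "of_real (1 - Re \<zeta>) \<noteq> (0 :: complex)" by simp
  then show ?thesis
    using levy_poly_mult[OF assms, of p] False by (simp add: levy_kernel_def field_simps)
qed

lemma continuous_levy_poly: "continuous_on A (levy_poly p)"
proof (induction p rule: induct_nat_012)
  case (ge2 p)
  then show ?case by (simp only: levy_poly.simps) (intro continuous_intros)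
qed (simp_all)

lemma integral_levy_poly_Suc_Suc:
  assumes M: "circle_measure M"
  shows "(\<integral>\<zeta>. levy_poly (Suc (Suc p)) \<zeta> \<partial>M) =
    2 * (\<integral>\<zeta>. levy_poly (Suc p) \<zeta> \<partial>M) - (\<integral>\<zeta>. levy_poly p \<zeta> \<partial>M) - 2 * moment M (Suc p)"
proof -
  have i: "integrable M (levy_poly q)" "integrable M (\<lambda>\<zeta>. \<zeta> ^ Suc p)" for q
    by (intro circle_integrable M continuous_levy_poly continuous_intros)+
  show ?thesis unfolding levy_poly.simps moment_def using i by simp
qed

lemma norm_integral_levy_poly:
  "\<exists>C\<ge>0. \<forall>M. circle_measure M \<longrightarrow> norm (\<integral>\<zeta>. levy_poly p \<zeta> \<partial>M) \<le> C * measure M (space M)"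
proof -
  have "compact (levy_poly p ` sphere 0 1)"
    by (intro compact_continuous_image continuous_levy_poly) auto
  then obtain B where B: "\<And>x. x \<in> sphere 0 1 \<Longrightarrow> norm (levy_poly p x) \<le> B"
    by (metis bounded_iff compact_imp_bounded imageI)
  have "norm (\<integral>\<zeta>. levy_poly p \<zeta> \<partial>M) \<le> B * measure M (space M)" if "circle_measure M" for M
    by (rule circle_norm_integral_le[OF that]) (use B in auto)
  moreover have "B \<ge> 0" by (rule order_trans[OF norm_ge_zero B[of 1]]) simp
  ultimately show ?thesis by blast
qed

text \<open>Centring makes the linear term \<open>\<i> * p * Im \<zeta>\<close> integrate to \<open>0\<close>, so subtracting it from \<open>\<zeta> ^ p - 1\<close> is
  free, and the difference is \<open>1 - Re \<zeta>\<close> times the Levy kernel.\<close>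

lemma centred_moment:
  assumes M: "M \<in> circle_prob" and m: "Im (moment M 1) = 0"
  shows "moment M p = 1 + (\<integral>\<zeta>. levy_poly p \<zeta> \<partial>tilt M)"
proof -
  note M' = circle_prob_imp_circle_measure[OF M]
  have i: "integrable M (\<lambda>\<zeta>. \<zeta> ^ p)" "integrable M (\<lambda>\<zeta>. 1 :: complex)" "integrable M (\<lambda>\<zeta>. \<i> * of_nat p * of_real (Im \<zeta>))"
      "integrable M (\<lambda>\<zeta>. \<zeta>)"
    by (intro circle_integrable M' continuous_intros)+
  have "(\<integral>\<zeta>. Im \<zeta> \<partial>M) = 0" using m i(4) by (simp add: moment_def)
  then have 0: "(\<integral>\<zeta>. \<i> * of_nat p * of_real (Im \<zeta>) \<partial>M) = 0" by simp
  have "(\<integral>\<zeta>. levy_poly p \<zeta> \<partial>tilt M) = (\<integral>\<zeta>. of_real (1 - Re \<zeta>) * levy_poly p \<zeta> \<partial>M)"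
    by (intro integral_tilt M continuous_levy_poly)
  also have "\<dots> = (\<integral>\<zeta>. \<zeta> ^ p - 1 - \<i> * of_nat p * of_real (Im \<zeta>) \<partial>M)"
    by (rule circle_integral_cong[OF M'], rule levy_poly_mult)
  also have "\<dots> = (\<integral>\<zeta>. \<zeta> ^ p - 1 \<partial>M) - (\<integral>\<zeta>. \<i> * of_nat p * of_real (Im \<zeta>) \<partial>M)"
    by (rule Bochner_Integration.integral_diff[OF Bochner_Integration.integrable_diff[OF i(1) i(2)] i(3)])
  also have "\<dots> = moment M p - 1"
    unfolding 0 Bochner_Integration.integral_diff[OF i(1) i(2)]
    by (simp add: moment_def circle_prob_measure_space[OF M])
  finally show ?thesis by simp
qed

lemma levy_kernel_minus:
  assumes "norm \<zeta> = 1" shows "levy_kernel (- p) \<zeta> = cnj (levy_kernel p \<zeta>)"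
proof (cases "\<zeta> = 1")
  case True
  then show ?thesis by (simp add: levy_kernel_def)
next
  case False
  show ?thesis
    unfolding levy_kernel_def if_not_P[OF False] powi_minus_circle[OF assms]
    by (simp only: complex_cnj_divide complex_cnj_diff complex_cnj_mult complex_cnj_i complex_cnj_complex_of_real
        complex_cnj_of_int complex_cnj_one of_int_minus mult_minus_left mult_minus_right)
qed

section \<open>Centring a measure\<close>

text \<open>A centring by the direction of the mean, rather than by a mean angle, makes the mean of the
  rotated measure real and its modulus unchanged.\<close>

definition centre :: "complex measure \<Rightarrow> complex measure" where
  "centre M = rotate (cnj (sgn (moment M 1))) M"

definition spread :: "complex measure \<Rightarrow> real" where
  "spread M = 1 - norm (moment M 1)"

lemma
  assumes M: "M \<in> circle_prob" and nz: "moment M 1 \<noteq> 0"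
  shows centre_circle_prob: "centre M \<in> circle_prob"
    and moment_centre_1: "moment (centre M) 1 = of_real (norm (moment M 1))"
    and moment_eq_centre: "moment M p = sgn (moment M 1) ^ p * moment (centre M) p"
    and B_transform_eq_centre: "norm z < 1 \<Longrightarrow>
      B_transform M z = sgn (moment M 1) * B_transform (centre M) (sgn (moment M 1) * z)"
proof -
  define \<omega> where "\<omega> = sgn (moment M 1)"
  have \<omega>: "norm \<omega> = 1" "norm (cnj \<omega>) = 1" using nz by (simp_all add: \<omega>_def norm_sgn)
  have inv: "\<omega> * cnj \<omega> = 1" using \<omega> by (simp add: complex_norm_square[symmetric])
  have c: "centre M = rotate (cnj \<omega>) M" by (simp add: centre_def \<omega>_def)
  show "centre M \<in> circle_prob" unfolding c by (rule rotate_circle_prob[OF M \<omega>(2)])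
  have m: "moment M 1 = \<omega> * of_real (norm (moment M 1))"
    using nz by (simp add: \<omega>_def sgn_eq)
  have "moment (centre M) 1 = cnj \<omega> * moment M 1"
    unfolding c by (simp add: moment_rotate[OF M \<omega>(2)])
  also have "\<dots> = (\<omega> * cnj \<omega>) * of_real (norm (moment M 1))"
    by (subst m) (simp add: mult_ac)
  finally show "moment (centre M) 1 = of_real (norm (moment M 1))" by (simp add: inv)
  have "\<omega> ^ p * moment (centre M) p = (\<omega> * cnj \<omega>) ^ p * moment M p"
    unfolding c by (simp add: moment_rotate[OF M \<omega>(2)] power_mult_distrib)
  then show "moment M p = sgn (moment M 1) ^ p * moment (centre M) p"
    unfolding inv \<omega>_def[symmetric] by simp
  assume z: "norm z < 1"
  then have "norm (\<omega> * z) < 1" using \<omega> by (simp add: norm_mult)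
  from B_transform_rotate[OF M \<omega>(2) this]
  have "\<omega> * B_transform (centre M) (\<omega> * z) = (\<omega> * cnj \<omega>) * B_transform M ((\<omega> * cnj \<omega>) * z)"
    unfolding c by (simp add: mult_ac)
  then show "B_transform M z = sgn (moment M 1) * B_transform (centre M) (sgn (moment M 1) * z)"
    unfolding inv \<omega>_def[symmetric] by simp
qed

lemma spread_nonneg: "M \<in> circle_prob \<Longrightarrow> 0 \<le> spread M"
  using norm_moment_le[OF circle_prob_imp_circle_measure, of M 1]
  by (simp add: spread_def circle_prob_measure_space)

lemma spread_le: "spread M \<le> norm (1 - moment M 1)"
  using norm_triangle_ineq2[of 1 "moment M 1"] by (simp add: spread_def)

lemma measure_tilt_centre:
  assumes "M \<in> circle_prob" "moment M 1 \<noteq> 0"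
  shows "measure (tilt (centre M)) (space (tilt (centre M))) = spread M"
  using assms by (simp add: measure_tilt centre_circle_prob moment_centre_1 spread_def del: One_nat_def)

lemma norm_sgn_minus_1_le:
  fixes m :: complex
  assumes "m \<noteq> 0" "norm m \<le> 1"
  shows "norm (sgn m - 1) \<le> 2 * norm (1 - m)"
proof -
  have "sgn m - m = of_real (1 - norm m) * sgn m" using assms by (simp add: sgn_eq field_simps)
  then have "norm (sgn m - m) = 1 - norm m"
    using assms by (simp only: norm_mult norm_of_real norm_sgn) simp
  moreover have "1 - norm m \<le> norm (1 - m)" using norm_triangle_ineq2[of 1 m] by simp
  moreover have "norm (sgn m - 1) \<le> norm (sgn m - m) + norm (1 - m)"
    using norm_triangle_ineq4[of "sgn m - m" "1 - m"] by simp
  ultimately show ?thesis by linarith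
qed

text \<open>The constant \<open>26\<close> is \<open>18\<close> from the centred estimate and \<open>4 * 2\<close> from replacing the rotated argument
  by \<open>z\<close>, the rotation being within \<open>2 * \<delta>\<close> of \<open>1\<close>.\<close>

lemma B_transform_approx:
  assumes M: "M \<in> circle_prob" and nz: "moment M 1 \<noteq> 0"
    and \<delta>: "norm (1 - moment M 1) \<le> \<delta>" "\<delta> \<le> 1 / 6" and z: "norm z \<le> 1 / 2" "z \<noteq> 0"
  shows "norm (B_transform M z / sgn (moment M 1) - 1 + herglotz (tilt (centre M)) z) \<le> 26 * \<delta> * spread M"
proof -
  define \<omega> where "\<omega> = sgn (moment M 1)"
  have \<omega>: "norm \<omega> = 1" "\<omega> \<noteq> 0" using nz by (auto simp: \<omega>_def norm_sgn sgn_eq_0_iff)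
  define d where "d = spread M"
  have d: "0 \<le> d" "d \<le> \<delta>" using spread_nonneg[OF M] spread_le[of M] \<delta> by (auto simp: d_def)
  have C: "centre M \<in> circle_prob" "Im (moment (centre M) 1) = 0" "1 - Re (moment (centre M) 1) = d"
    unfolding moment_centre_1[OF M nz] d_def spread_def by (rule centre_circle_prob[OF M nz], simp_all)
  have z': "norm (\<omega> * z) \<le> 1 / 2" "\<omega> * z \<noteq> 0" using z \<omega> by (auto simp: norm_mult)
  let ?h = "herglotz (tilt (centre M))"
  have "norm z < 1" using z(1) by simp
  then have "B_transform M z = \<omega> * B_transform (centre M) (\<omega> * z)"
    unfolding \<omega>_def by (rule B_transform_eq_centre[OF M nz])
  then have B: "B_transform M z / \<omega> = B_transform (centre M) (\<omega> * z)"
    using \<omega>(2) by simp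
  have "norm (B_transform (centre M) (\<omega> * z) - 1 + ?h (\<omega> * z)) \<le> 18 * d\<^sup>2"
    using centred_B_transform_approx[OF C(1,2) z'] d \<delta> unfolding C(3) by linarith
  also have "18 * d\<^sup>2 \<le> 18 * (\<delta> * d)" using d by (simp add: power2_eq_square mult_right_mono)
  finally have 1: "norm (B_transform (centre M) (\<omega> * z) - 1 + ?h (\<omega> * z)) \<le> 18 * (\<delta> * d)" .
  have "norm (moment M 1) \<le> 1" using spread_nonneg[OF M] by (simp add: spread_def)
  then have "norm (\<omega> - 1) \<le> 2 * \<delta>"
    using norm_sgn_minus_1_le[OF nz] \<delta> unfolding \<omega>_def by linarith
  then have le: "4 * norm (\<omega> - 1) * d \<le> 4 * (2 * \<delta>) * d"
    by (intro mult_right_mono mult_left_mono d(1)) simp_all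
  have "norm (?h (\<omega> * z) - ?h z) \<le> 4 * norm (\<omega> - 1) * d"
    using norm_herglotz_diff_le[OF tilt_circle_measure[OF C(1)] z(1) \<omega>(1)]
    unfolding measure_tilt_centre[OF M nz] d_def .
  also note le
  also have "4 * (2 * \<delta>) * d = 8 * (\<delta> * d)" by simp
  finally have 2: "norm (?h (\<omega> * z) - ?h z) \<le> 8 * (\<delta> * d)" .
  have "B_transform (centre M) (\<omega> * z) - 1 + ?h z
      = (B_transform (centre M) (\<omega> * z) - 1 + ?h (\<omega> * z)) - (?h (\<omega> * z) - ?h z)" by simp
  then have "norm (B_transform (centre M) (\<omega> * z) - 1 + ?h z)
      \<le> norm (B_transform (centre M) (\<omega> * z) - 1 + ?h (\<omega> * z)) + norm (?h (\<omega> * z) - ?h z)"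
    by (simp only: norm_triangle_ineq4)
  also have "\<dots> \<le> 18 * (\<delta> * d) + 8 * (\<delta> * d)" by (rule add_mono[OF 1 2])
  finally have "norm (B_transform (centre M) (\<omega> * z) - 1 + ?h z) \<le> 26 * \<delta> * d" by simp
  then show ?thesis unfolding B[symmetric] unfolding \<omega>_def d_def .
qed

text \<open>The integrand \<open>|1 - \<zeta>|\<close> is at most \<open>\<epsilon>\<close> near \<open>1\<close> and at most \<open>2\<close> elsewhere.\<close>

lemma norm_one_minus_moment_le:
  assumes M: "M \<in> circle_prob" and \<epsilon>: "0 \<le> \<epsilon>"
  shows "norm (1 - moment M 1) \<le> \<epsilon> + 2 * measure M {\<zeta> \<in> sphere 0 1. cmod (\<zeta> - 1) \<ge> \<epsilon>}"
proof -
  note M' = circle_prob_imp_circle_measure[OF M]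
  interpret finite_measure M using circle_measureD(1)[OF M'] .
  let ?E = "{\<zeta> \<in> sphere 0 1. cmod (\<zeta> - 1) \<ge> \<epsilon>}"
  have E: "?E \<in> sets M"
  proof -
    have "closed {\<zeta>::complex. cmod (\<zeta> - 1) \<ge> \<epsilon>}" by (intro closed_Collect_le continuous_intros)
    then have "sphere 0 1 \<inter> {\<zeta>. cmod (\<zeta> - 1) \<ge> \<epsilon>} \<in> sets circle_borel"
      unfolding circle_borel_def sets_restrict_space by (intro imageI) (rule borel_closed)
    then show ?thesis using circle_measureD(2)[OF M'] by (simp add: Int_def)
  qed
  have i: "integrable M (\<lambda>\<zeta>. 1 :: complex)" "integrable M (\<lambda>\<zeta>. \<zeta>)" "integrable M (\<lambda>\<zeta>. norm (1 - \<zeta>))"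
    "integrable M (\<lambda>\<zeta>. \<epsilon>)"
    by (intro circle_integrable M' continuous_intros)+
  have iE: "integrable M (\<lambda>\<zeta>. 2 * indicator ?E \<zeta> :: real)"
    using E by (intro integrable_mult_right integrable_real_indicator) (auto simp: emeasure_eq_measure)
  have "norm (1 - moment M 1) = norm (\<integral>\<zeta>. 1 - \<zeta> \<partial>M)"
    using i by (simp add: moment_def circle_prob_measure_space[OF M])
  also have "\<dots> \<le> (\<integral>\<zeta>. norm (1 - \<zeta>) \<partial>M)" by (rule integral_norm_bound)
  also have "\<dots> \<le> (\<integral>\<zeta>. \<epsilon> + 2 * indicator ?E \<zeta> \<partial>M)"
  proof (intro integral_mono_AE AE_I2 i Bochner_Integration.integrable_add iE)
    fix \<zeta> assume "\<zeta> \<in> space M"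
    then have \<zeta>: "norm \<zeta> = 1" using circle_measureD(3)[OF M'] by simp
    have "norm (1 - \<zeta>) \<le> 2" using norm_triangle_ineq4[of 1 \<zeta>] \<zeta> by simp
    then show "norm (1 - \<zeta>) \<le> \<epsilon> + 2 * indicator ?E \<zeta>"
      using \<zeta> \<epsilon> by (auto simp: indicator_def norm_minus_commute)
  qed
  also have "\<dots> = \<epsilon> + 2 * measure M ?E"
    using i(4) iE E circle_prob_measure_space[OF M] by (subst Bochner_Integration.integral_add) (auto simp: emeasure_eq_measure)
  finally show ?thesis .
qed

text \<open>Uniform closeness of the means to \<open>1\<close> makes both the rotations and the spreads of the entries
  uniformly small.\<close>

lemma infinitesimal_imp_moments_tendsto_1:
  assumes inf: "infinitesimal_array k M" and k: "\<And>n. k n \<ge> 1"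
    and M: "\<And>n i. i \<in> {1..k n} \<Longrightarrow> M n i \<in> circle_prob"
  shows "(\<lambda>n. MAX i\<in>{1..k n}. norm (1 - moment (M n i) 1)) \<longlonglongrightarrow> 0"
proof (rule LIMSEQ_I)
  fix e :: real assume e: "e > 0"
  let ?E = "{\<zeta> \<in> sphere 0 1. cmod (\<zeta> - 1) \<ge> e / 4}"
  have "(\<lambda>n. MAX i\<in>{1..k n}. measure (M n i) ?E) \<longlonglongrightarrow> 0"
    by (rule inf[unfolded infinitesimal_array_def, rule_format]) (use e in simp)
  from LIMSEQ_D[OF this, of "e / 4"] e obtain n0 where n0:
      "\<And>n. n \<ge> n0 \<Longrightarrow> \<bar>MAX i\<in>{1..k n}. measure (M n i) ?E\<bar> < e / 4" by auto
  show "\<exists>n0. \<forall>n\<ge>n0. norm ((MAX i\<in>{1..k n}. norm (1 - moment (M n i) 1)) - 0) < e"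
  proof (intro exI allI impI)
    fix n assume n: "n \<ge> n0"
    have ne: "{1..k n} \<noteq> {}" using k[of n] by simp
    have "norm (1 - moment (M n i) 1) < e" if i: "i \<in> {1..k n}" for i
    proof -
      have "measure (M n i) ?E \<le> (MAX i\<in>{1..k n}. measure (M n i) ?E)" using i by (intro Max_ge) auto
      then have "measure (M n i) ?E < e / 4" using n0[OF n] by linarith
      then show ?thesis using norm_one_minus_moment_le[OF M[OF i], of "e / 4"] e by linarith
    qed
    then have "(MAX i\<in>{1..k n}. norm (1 - moment (M n i) 1)) < e" using ne by (subst Max_less_iff) auto
    moreover have "norm (1 - moment (M n 1) 1) \<le> (MAX i\<in>{1..k n}. norm (1 - moment (M n i) 1))"
      using k[of n] by (intro Max_ge) auto
    then have "0 \<le> (MAX i\<in>{1..k n}. norm (1 - moment (M n i) 1))" by (rule order_trans[OF norm_ge_zero])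
    ultimately show "norm ((MAX i\<in>{1..k n}. norm (1 - moment (M n i) 1)) - 0) < e" by simp
  qed
qed

section \<open>Passage to the limit along an infinitesimal array\<close>

context
  fixes k :: "nat \<Rightarrow> nat" and M :: "nat \<Rightarrow> nat \<Rightarrow> complex measure" and lam :: "nat \<Rightarrow> complex"
    and \<gamma> :: complex and \<sigma> :: "complex measure" and \<delta> :: "nat \<Rightarrow> real"
  assumes M: "\<And>n i. i \<in> {1..k n} \<Longrightarrow> M n i \<in> circle_prob"
    and nz: "\<And>n i. i \<in> {1..k n} \<Longrightarrow> moment (M n i) 1 \<noteq> 0"
    and lam: "\<And>n. norm (lam n) = 1" and \<gamma>: "norm \<gamma> = 1" and \<sigma>: "circle_measure \<sigma>"
    and \<delta>: "\<delta> \<longlonglongrightarrow> 0" "\<And>n. 0 \<le> \<delta> n"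
    and close: "\<And>n i. i \<in> {1..k n} \<Longrightarrow> norm (1 - moment (M n i) 1) \<le> \<delta> n"
    and weak: "circle_weak_conv (\<lambda>n. conv_row bool_mult_conv (lam n) (M n) (k n)) (bool_infdiv \<gamma> \<sigma>)"
begin

lemma B_product_tendsto:
  assumes z: "norm z < 1"
  shows "(\<lambda>n. lam n * (\<Prod>i\<in>{1..k n}. B_transform (M n i) z)) \<longlonglongrightarrow> \<gamma> * exp (- herglotz \<sigma> z)"
proof -
  have row: "conv_row bool_mult_conv (lam n) (M n) (k n) \<in> circle_prob \<and>
         (\<forall>z\<in>ball 0 1. B_transform (conv_row bool_mult_conv (lam n) (M n) (k n)) z = lam n * (\<Prod>i\<in>{1..k n}. B_transform (M n i) z))" for n
    by (rule bool_conv_row[OF lam M])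
  have "(\<lambda>n. B_transform (conv_row bool_mult_conv (lam n) (M n) (k n)) z) \<longlonglongrightarrow> B_transform (bool_infdiv \<gamma> \<sigma>) z"
    by (rule B_transform_tendsto[OF weak]) (use row bool_infdiv(1)[OF \<gamma> \<sigma>] z in auto)
  then show ?thesis
    using row z bool_infdiv(2)[OF \<gamma> \<sigma>, of z] by (simp add: herglotz_def)
qed

lemma prod_norm_moment_tendsto:
  "(\<lambda>n. \<Prod>i\<in>{1..k n}. norm (moment (M n i) 1)) \<longlonglongrightarrow> exp (- measure \<sigma> (space \<sigma>))"
proof -
  have h0: "herglotz \<sigma> 0 = of_real (measure \<sigma> (space \<sigma>))"
    by (simp add: herglotz_def scaleR_conv_of_real)
  have "(\<lambda>n. norm (lam n * (\<Prod>i\<in>{1..k n}. B_transform (M n i) 0))) \<longlonglongrightarrow> norm (\<gamma> * exp (- herglotz \<sigma> 0))"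
    by (intro tendsto_norm B_product_tendsto) simp
  moreover have "norm (lam n * (\<Prod>i\<in>{1..k n}. B_transform (M n i) 0)) = (\<Prod>i\<in>{1..k n}. norm (moment (M n i) 1))" for n
    using M B_transform_0 by (simp add: norm_mult lam prod_norm[symmetric])
  ultimately show ?thesis by (simp add: h0 norm_mult \<gamma>)
qed

text \<open>Writing \<open>S\<close> for the sum of the spreads, \<open>1 - d \<le> exp (- d)\<close> turns the lower bound on the product
  of the \<open>1 - d\<close> into an upper bound on \<open>S\<close>. With \<open>S\<close> bounded, the product and \<open>exp (- S)\<close> have
  the same limit.\<close>

lemma sum_spread_tendsto: "(\<lambda>n. \<Sum>i\<in>{1..k n}. spread (M n i)) \<longlonglongrightarrow> measure \<sigma> (space \<sigma>)"
proof -
  define S where "S n = (\<Sum>i\<in>{1..k n}. spread (M n i))" for n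
  define s where "s = measure \<sigma> (space \<sigma>)"
  have le: "(\<Prod>i\<in>{1..k n}. norm (moment (M n i) 1)) \<le> exp (- S n)" for n
  proof -
    have "norm (moment (M n i) 1) \<le> exp (- spread (M n i))" for i
      using exp_ge_add_one_self[of "- spread (M n i)"] by (simp add: spread_def)
    then have "(\<Prod>i\<in>{1..k n}. norm (moment (M n i) 1)) \<le> (\<Prod>i\<in>{1..k n}. exp (- spread (M n i)))"
      by (intro prod_mono) auto
    then show ?thesis by (simp add: S_def exp_sum[symmetric] sum_negf)
  qed
  \<comment> \<open>any number in \<open>(0, exp (- s))\<close> is an eventual lower bound for the products\<close>
  have "exp (- s - 1) < exp (- s)" by simp
  then have "eventually (\<lambda>n. exp (- s - 1) < (\<Prod>i\<in>{1..k n}. norm (moment (M n i) 1))) sequentially"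
    using prod_norm_moment_tendsto unfolding s_def[symmetric] by (rule order_tendstoD(1)[rotated])
  then have bounded: "eventually (\<lambda>n. S n \<le> s + 1) sequentially"
  proof eventually_elim
    case (elim n)
    then have "exp (- s - 1) < exp (- S n)" using le[of n] by linarith
    then show ?case by simp
  qed
  have "(\<lambda>n. (\<Prod>i\<in>{1..k n}. 1 + (- of_real (spread (M n i)))) - exp (\<Sum>i\<in>{1..k n}. - of_real (spread (M n i)) :: complex)) \<longlonglongrightarrow> 0"
  proof (rule prod_minus_exp_tendsto_0[OF _ \<delta>, where C = 1 and d = "\<lambda>n i. spread (M n i)" and K = "s + 1"])
    show "eventually (\<lambda>n. (\<Sum>i\<in>{1..k n}. spread (M n i)) \<le> s + 1) sequentially"
      using bounded by (simp add: S_def)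
    fix n i assume i: "i \<in> {1..k n}"
    note sp = spread_nonneg[OF M[OF i]]
    show "0 \<le> spread (M n i) \<and> spread (M n i) \<le> \<delta> n"
      using sp close[OF i] spread_le[of "M n i"] by simp
    have "1 + - complex_of_real (spread (M n i)) = of_real (norm (moment (M n i) 1))" by (simp add: spread_def)
    then show "norm (1 + - complex_of_real (spread (M n i))) \<le> 1 \<and> Re (- of_real (spread (M n i))) \<le> 0"
      using sp by (simp add: spread_def)
    show "norm (- complex_of_real (spread (M n i))) \<le> 1 * spread (M n i)" using sp by simp
  next
    have "0 \<le> 1 * \<delta> n * spread (M n i)" if "i \<in> {1..k n}" for n i
      using spread_nonneg[OF M[OF that]] \<delta>(2)[of n] by simp
    then show "eventually (\<lambda>n. \<forall>i\<in>{1..k n}. norm (- complex_of_real (spread (M n i)) - - of_real (spread (M n i)))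
        \<le> 1 * \<delta> n * spread (M n i)) sequentially" by simp
  qed auto
  moreover have "(\<Prod>i\<in>{1..k n}. 1 + (- of_real (spread (M n i)))) - exp (\<Sum>i\<in>{1..k n}. - of_real (spread (M n i)) :: complex)
      = of_real ((\<Prod>i\<in>{1..k n}. norm (moment (M n i) 1)) - exp (- S n))" for n
  proof -
    have "(\<Sum>i\<in>{1..k n}. - of_real (spread (M n i))) = complex_of_real (- S n)"
      by (simp add: S_def sum_negf)
    moreover have "1 + - complex_of_real (spread (M n i)) = of_real (norm (moment (M n i) 1))" for i
      by (simp add: spread_def)
    ultimately show ?thesis by (simp only: exp_of_real of_real_prod of_real_diff)
  qed
  ultimately have "(\<lambda>n. complex_of_real ((\<Prod>i\<in>{1..k n}. norm (moment (M n i) 1)) - exp (- S n))) \<longlonglongrightarrow> of_real 0"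
    by simp
  then have "(\<lambda>n. (\<Prod>i\<in>{1..k n}. norm (moment (M n i) 1)) - exp (- S n)) \<longlonglongrightarrow> 0"
    by (simp only: tendsto_of_real_iff)
  from tendsto_diff[OF prod_norm_moment_tendsto this] have "(\<lambda>n. exp (- S n)) \<longlonglongrightarrow> exp (- s)" by (simp add: s_def)
  then have "(\<lambda>n. - ln (exp (- S n))) \<longlonglongrightarrow> - ln (exp (- s))" by (intro tendsto_minus tendsto_ln) auto
  then show ?thesis by (simp add: S_def s_def)
qed

lemma sum_spread_bounded: "\<exists>K. \<forall>n. (\<Sum>i\<in>{1..k n}. spread (M n i)) \<le> K"
proof -
  have "Bseq (\<lambda>n. \<Sum>i\<in>{1..k n}. spread (M n i))"
    using sum_spread_tendsto by (intro convergent_imp_Bseq) (auto simp: convergent_def)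
  then obtain K where K: "\<And>n. norm (\<Sum>i\<in>{1..k n}. spread (M n i)) \<le> K" by (auto simp: Bseq_def)
  have "(\<Sum>i\<in>{1..k n}. spread (M n i)) \<le> K" for n
    using K[of n] unfolding real_norm_def by linarith
  then show ?thesis by blast
qed

lemma prod_one_plus_minus_exp_tendsto_0:
  fixes x y :: "nat \<Rightarrow> nat \<Rightarrow> complex"
  assumes "C \<ge> 0"
    and "\<And>n i. i \<in> {1..k n} \<Longrightarrow> norm (1 + x n i) \<le> 1 \<and> Re (y n i) \<le> 0"
    and "\<And>n i. i \<in> {1..k n} \<Longrightarrow> norm (y n i) \<le> C * spread (M n i)"
    and "eventually (\<lambda>n. \<forall>i\<in>{1..k n}. norm (x n i - y n i) \<le> C * \<delta> n * spread (M n i)) sequentially"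
  shows "(\<lambda>n. (\<Prod>i\<in>{1..k n}. 1 + x n i) - exp (\<Sum>i\<in>{1..k n}. y n i)) \<longlonglongrightarrow> 0"
proof -
  obtain K where K: "\<And>n. (\<Sum>i\<in>{1..k n}. spread (M n i)) \<le> K" using sum_spread_bounded by blast
  show ?thesis
  proof (rule prod_minus_exp_tendsto_0[OF _ \<delta> assms(1), where d = "\<lambda>n i. spread (M n i)" and K = K])
    show "0 \<le> spread (M n i) \<and> spread (M n i) \<le> \<delta> n" if "i \<in> {1..k n}" for n i
      using spread_nonneg[OF M[OF that]] close[OF that] spread_le[of "M n i"] by simp
  qed (use assms K in auto)
qed

text \<open>The unimodular part of the value at \<open>0\<close> of the \<open>B\<close>-transform of the row.\<close>

definition drift :: "nat \<Rightarrow> complex" where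
  "drift n = lam n * (\<Prod>i\<in>{1..k n}. sgn (moment (M n i) 1))"

lemma drift_tendsto: "drift \<longlonglongrightarrow> \<gamma>"
proof -
  have h0: "herglotz \<sigma> 0 = of_real (measure \<sigma> (space \<sigma>))"
    by (simp add: herglotz_def scaleR_conv_of_real)
  have p: "(\<Prod>i\<in>{1..k n}. moment (M n i) 1) =
     (\<Prod>i\<in>{1..k n}. sgn (moment (M n i) 1)) * of_real (\<Prod>i\<in>{1..k n}. norm (moment (M n i) 1))" for n
    unfolding of_real_prod prod.distrib[symmetric] using nz by (intro prod.cong) (auto simp: sgn_eq)
  have pos: "(\<Prod>i\<in>{1..k n}. norm (moment (M n i) 1)) \<noteq> 0" for n using nz by (simp add: prod_zero_iff)
  have "(\<lambda>n. lam n * (\<Prod>i\<in>{1..k n}. B_transform (M n i) 0)) \<longlonglongrightarrow> \<gamma> * exp (- herglotz \<sigma> 0)"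
    by (rule B_product_tendsto) simp
  moreover have "(\<Prod>i\<in>{1..k n}. B_transform (M n i) 0) = (\<Prod>i\<in>{1..k n}. moment (M n i) 1)" for n
    by (intro prod.cong refl) (rule B_transform_0[OF M])
  ultimately have "(\<lambda>n. (lam n * (\<Prod>i\<in>{1..k n}. moment (M n i) 1)) / of_real (\<Prod>i\<in>{1..k n}. norm (moment (M n i) 1)))
      \<longlonglongrightarrow> (\<gamma> * exp (- herglotz \<sigma> 0)) / of_real (exp (- measure \<sigma> (space \<sigma>)))"
    by (intro tendsto_divide tendsto_of_real prod_norm_moment_tendsto) auto
  moreover have "(\<gamma> * exp (- herglotz \<sigma> 0)) / of_real (exp (- measure \<sigma> (space \<sigma>))) = \<gamma>"
    by (simp add: h0 exp_of_real[symmetric])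
  moreover have "(lam n * (\<Prod>i\<in>{1..k n}. moment (M n i) 1)) / of_real (\<Prod>i\<in>{1..k n}. norm (moment (M n i) 1)) = drift n" for n
    unfolding p drift_def using pos[of n] by (simp del: of_real_prod)
  ultimately show ?thesis by simp
qed

text \<open>Divide the row of \<open>B\<close>-transforms by the drift, so that every factor is close to \<open>1\<close>, and compare
  the product with the exponential of the sum of the first-order terms.\<close>

lemma exp_herglotz_tendsto:
  assumes z: "norm z \<le> 1 / 2" "z \<noteq> 0"
  shows "(\<lambda>n. exp (- (\<Sum>i\<in>{1..k n}. herglotz (tilt (centre (M n i))) z))) \<longlonglongrightarrow> exp (- herglotz \<sigma> z)"
proof -
  have z1: "norm z < 1" using z by simp
  have \<gamma>0: "\<gamma> \<noteq> 0" using \<gamma> by auto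
  let ?\<omega> = "\<lambda>n i. sgn (moment (M n i) 1)" and ?B = "\<lambda>n i. B_transform (M n i) z"
  have \<omega>: "norm (?\<omega> n i) = 1" "?\<omega> n i \<noteq> 0" if "i \<in> {1..k n}" for n i
    using nz[OF that] by (auto simp: norm_sgn sgn_eq_0_iff)
  have diff: "(\<lambda>n. (\<Prod>i\<in>{1..k n}. 1 + (?B n i / ?\<omega> n i - 1)) - exp (\<Sum>i\<in>{1..k n}. - herglotz (tilt (centre (M n i))) z)) \<longlonglongrightarrow> 0"
  proof (rule prod_one_plus_minus_exp_tendsto_0[where C = 26])
    fix n i assume i: "i \<in> {1..k n}"
    note T = tilt_circle_measure[OF centre_circle_prob[OF M[OF i] nz[OF i]]]
    show "norm (1 + (?B n i / ?\<omega> n i - 1)) \<le> 1 \<and> Re (- herglotz (tilt (centre (M n i))) z) \<le> 0"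
      using \<omega>[OF i] norm_B_transform_le_1[OF M[OF i] z1] Re_herglotz_nonneg[OF T z1] by (simp add: norm_divide)
    show "norm (- herglotz (tilt (centre (M n i))) z) \<le> 26 * spread (M n i)"
      using norm_herglotz_le[OF T z(1)] spread_nonneg[OF M[OF i]]
      unfolding measure_tilt_centre[OF M[OF i] nz[OF i]] by simp
  next
    have "eventually (\<lambda>n. \<delta> n < 1 / 6) sequentially" by (rule order_tendstoD[OF \<delta>(1)]) simp
    then show "eventually (\<lambda>n. \<forall>i\<in>{1..k n}. norm (?B n i / ?\<omega> n i - 1 - - herglotz (tilt (centre (M n i))) z)
        \<le> 26 * \<delta> n * spread (M n i)) sequentially"
    proof eventually_elim
      case (elim n)
      show ?case
      proof
        fix i assume i: "i \<in> {1..k n}"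
        show "norm (?B n i / ?\<omega> n i - 1 - - herglotz (tilt (centre (M n i))) z) \<le> 26 * \<delta> n * spread (M n i)"
          using B_transform_approx[OF M[OF i] nz[OF i] close[OF i] _ z] elim by simp
      qed
    qed
  qed simp
  have "(\<lambda>n. (lam n * (\<Prod>i\<in>{1..k n}. ?B n i)) / drift n) \<longlonglongrightarrow> (\<gamma> * exp (- herglotz \<sigma> z)) / \<gamma>"
    by (intro tendsto_divide B_product_tendsto z1 drift_tendsto \<gamma>0)
  moreover have "(lam n * (\<Prod>i\<in>{1..k n}. ?B n i)) / drift n = (\<Prod>i\<in>{1..k n}. 1 + (?B n i / ?\<omega> n i - 1))" for n
    using lam[of n] by (auto simp: drift_def prod_dividef)
  ultimately have "(\<lambda>n. \<Prod>i\<in>{1..k n}. 1 + (?B n i / ?\<omega> n i - 1)) \<longlonglongrightarrow> exp (- herglotz \<sigma> z)"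
    using \<gamma>0 by simp
  from tendsto_diff[OF this diff] show ?thesis by (simp add: sum_negf)
qed

text \<open>The moments are, up to a factor \<open>2\<close>, the Taylor coefficients of the Herglotz integrals, whose
  exponentials converge near \<open>0\<close>. The zeroth coefficient is the total mass, whose convergence
  fixes the branch of the logarithm.\<close>

lemma sum_moment_tilt_tendsto:
  "(\<lambda>n. \<Sum>i\<in>{1..k n}. moment (tilt (centre (M n i))) j) \<longlonglongrightarrow> moment \<sigma> j"
proof -
  define s where "s = measure \<sigma> (space \<sigma>)"
  obtain K where K: "\<And>n. (\<Sum>i\<in>{1..k n}. spread (M n i)) \<le> K" using sum_spread_bounded by blast
  let ?T = "\<lambda>n i. tilt (centre (M n i))"
  have T: "circle_measure (?T n i)" "measure (?T n i) (space (?T n i)) = spread (M n i)" if "i \<in> {1..k n}" for n i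
    using tilt_circle_measure[OF centre_circle_prob] measure_tilt_centre M[OF that] nz[OF that] by auto
  \<comment> \<open>Taylor coefficients of the difference of the Herglotz integrals of \<open>\<sigma>\<close> and of the row\<close>
  define a where "a n j = (if j = 0 then 1 else 2) * (moment \<sigma> j - (\<Sum>i\<in>{1..k n}. moment (?T n i) j))" for n j
  have "(\<lambda>n. a n j) \<longlonglongrightarrow> 0"
  proof (rule exp_powser_coeff_tendsto_0)
    fix n j
    have "norm (\<Sum>i\<in>{1..k n}. moment (?T n i) j) \<le> (\<Sum>i\<in>{1..k n}. spread (M n i))"
      by (rule sum_norm_le) (use norm_moment_le[OF T(1)] T(2) in auto)
    then have "norm (moment \<sigma> j - (\<Sum>i\<in>{1..k n}. moment (?T n i) j)) \<le> s + K"
      using K[of n] norm_moment_le[OF \<sigma>, of j] norm_triangle_ineq4[of "moment \<sigma> j" "\<Sum>i\<in>{1..k n}. moment (?T n i) j"]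
      unfolding s_def by linarith
    moreover from this have "0 \<le> s + K" using norm_ge_zero order_trans by blast
    moreover have "norm (a n j) = (if j = 0 then 1 else 2) * norm (moment \<sigma> j - (\<Sum>i\<in>{1..k n}. moment (?T n i) j))"
      unfolding a_def norm_mult by simp
    ultimately show "norm (a n j) \<le> 2 * (s + K)" by (simp split: if_splits)
  next
    have "(\<lambda>n. of_real (s - (\<Sum>i\<in>{1..k n}. spread (M n i))) :: complex) \<longlonglongrightarrow> of_real (s - s)"
      by (intro tendsto_intros) (use sum_spread_tendsto in \<open>simp add: s_def\<close>)
    moreover have "a n 0 = of_real (s - (\<Sum>i\<in>{1..k n}. spread (M n i)))" for n
      using T by (simp add: a_def moment_0 \<sigma> s_def)
    ultimately show "(\<lambda>n. a n 0) \<longlonglongrightarrow> 0" by simp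
  next
    fix x :: real assume x: "0 < x" "x < 1 / 2"
    let ?z = "complex_of_real x"
    have z: "norm ?z \<le> 1 / 2" "?z \<noteq> 0" "norm ?z < 1" using x by auto
    have "(\<lambda>j. (if j = 0 then 1 else 2) * moment \<sigma> j * ?z ^ j - (\<Sum>i\<in>{1..k n}. (if j = 0 then 1 else 2) * moment (?T n i) j * ?z ^ j))
       sums (herglotz \<sigma> ?z - (\<Sum>i\<in>{1..k n}. herglotz (?T n i) ?z))" for n
      by (intro sums_diff sums_sum herglotz_sums \<sigma> z T)
    moreover have "a n j * ?z ^ j = (if j = 0 then 1 else 2) * moment \<sigma> j * ?z ^ j -
        (\<Sum>i\<in>{1..k n}. (if j = 0 then 1 else 2) * moment (?T n i) j * ?z ^ j)" for n j
      unfolding a_def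
      by (simp only: left_diff_distrib right_diff_distrib sum_distrib_left sum_distrib_right mult.assoc)
    ultimately have "(\<lambda>j. a n j * ?z ^ j) sums (herglotz \<sigma> ?z - (\<Sum>i\<in>{1..k n}. herglotz (?T n i) ?z))" for n
      by simp
    then have "(\<Sum>j. a n j * ?z ^ j) = herglotz \<sigma> ?z - (\<Sum>i\<in>{1..k n}. herglotz (?T n i) ?z)" for n
      by (simp add: sums_iff)
    moreover have "(\<lambda>n. exp (herglotz \<sigma> ?z) * exp (- (\<Sum>i\<in>{1..k n}. herglotz (?T n i) ?z))) \<longlonglongrightarrow> exp (herglotz \<sigma> ?z) * exp (- herglotz \<sigma> ?z)"
      by (intro tendsto_mult tendsto_const exp_herglotz_tendsto z)
    ultimately show "(\<lambda>n. exp (\<Sum>j. a n j * ?z ^ j)) \<longlonglongrightarrow> 1"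
      by (simp add: exp_add[symmetric])
  qed
  then have "(\<lambda>n. moment \<sigma> j - a n j / (if j = 0 then 1 else 2)) \<longlonglongrightarrow> moment \<sigma> j - 0 / (if j = 0 then 1 else 2)"
    by (intro tendsto_intros) auto
  moreover have "a n j / (if j = 0 then 1 else 2) = moment \<sigma> j - (\<Sum>i\<in>{1..k n}. moment (?T n i) j)" for n
    unfolding a_def by (rule nonzero_mult_div_cancel_left) simp
  ultimately show ?thesis by simp
qed

lemma sum_levy_poly_tendsto:
  "(\<lambda>n. \<Sum>i\<in>{1..k n}. \<integral>\<zeta>. levy_poly p \<zeta> \<partial>tilt (centre (M n i))) \<longlonglongrightarrow> (\<integral>\<zeta>. levy_poly p \<zeta> \<partial>\<sigma>)"
proof (induction p rule: induct_nat_012)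
  case 0
  then show ?case by simp
next
  case 1
  have m: "(\<integral>\<zeta>. levy_poly (Suc 0) \<zeta> \<partial>L) = - moment L 0" for L by (simp add: moment_def)
  show ?case unfolding m sum_negf by (intro tendsto_minus sum_moment_tilt_tendsto)
next
  case (ge2 p)
  have T: "circle_measure (tilt (centre (M n i)))" if "i \<in> {1..k n}" for n i
    using tilt_circle_measure[OF centre_circle_prob] M[OF that] nz[OF that] by auto
  let ?I = "\<lambda>q n. \<Sum>i\<in>{1..k n}. \<integral>\<zeta>. levy_poly q \<zeta> \<partial>tilt (centre (M n i))"
  have "?I (Suc (Suc p)) n = 2 * ?I (Suc p) n - ?I p n - 2 * (\<Sum>i\<in>{1..k n}. moment (tilt (centre (M n i))) (Suc p))" for n
    unfolding sum_distrib_left sum_subtractf[symmetric]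
    by (intro sum.cong refl integral_levy_poly_Suc_Suc T)
  then show ?case unfolding integral_levy_poly_Suc_Suc[OF \<sigma>]
    using ge2.IH sum_moment_tilt_tendsto by (simp only:) (intro tendsto_intros)
qed

text \<open>The same comparison of a product with an exponential, now for the moments of the centred entries,
  where the first-order expansion is exact.\<close>

lemma moment_circle_conv_row_tendsto:
  "(\<lambda>n. moment (conv_row circle_conv (lam n) (M n) (k n)) p) \<longlonglongrightarrow> \<gamma> ^ p * exp (\<integral>\<zeta>. levy_poly p \<zeta> \<partial>\<sigma>)"
proof -
  obtain C where C: "C \<ge> 0" "\<And>L. circle_measure L \<Longrightarrow> norm (\<integral>\<zeta>. levy_poly p \<zeta> \<partial>L) \<le> C * measure L (space L)"
    using norm_integral_levy_poly[of p] by blast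
  let ?y = "\<lambda>n i. \<integral>\<zeta>. levy_poly p \<zeta> \<partial>tilt (centre (M n i))"
  have y: "moment (centre (M n i)) p = 1 + ?y n i" if "i \<in> {1..k n}" for n i
    using M[OF that] nz[OF that] by (intro centred_moment centre_circle_prob) (simp_all add: moment_centre_1 del: One_nat_def)
  have "(\<lambda>n. (\<Prod>i\<in>{1..k n}. 1 + ?y n i) - exp (\<Sum>i\<in>{1..k n}. ?y n i)) \<longlonglongrightarrow> 0"
  proof (rule prod_one_plus_minus_exp_tendsto_0[OF C(1)])
    fix n i assume i: "i \<in> {1..k n}"
    note P = centre_circle_prob[OF M[OF i] nz[OF i]]
    show "norm (?y n i) \<le> C * spread (M n i)"
      using C(2)[OF tilt_circle_measure[OF P]] by (simp add: measure_tilt_centre[OF M[OF i] nz[OF i]])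
    have 1: "norm (1 + ?y n i) \<le> 1"
      using norm_moment_le[OF circle_prob_imp_circle_measure[OF P], of p] unfolding y[OF i]
      by (simp add: circle_prob_measure_space[OF P])
    then have "Re (1 + ?y n i) \<le> 1" using complex_Re_le_cmod order_trans by blast
    with 1 show "norm (1 + ?y n i) \<le> 1 \<and> Re (?y n i) \<le> 0" by simp
  next
    show "eventually (\<lambda>n. \<forall>i\<in>{1..k n}. norm (?y n i - ?y n i) \<le> C * \<delta> n * spread (M n i)) sequentially"
      using C(1) \<delta>(2) spread_nonneg[OF M] by simp
  qed
  from tendsto_add[OF this tendsto_exp[OF sum_levy_poly_tendsto[of p]]]
  have "(\<lambda>n. \<Prod>i\<in>{1..k n}. 1 + ?y n i) \<longlonglongrightarrow> exp (\<integral>\<zeta>. levy_poly p \<zeta> \<partial>\<sigma>)" by simp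
  then have "(\<lambda>n. drift n ^ p * (\<Prod>i\<in>{1..k n}. 1 + ?y n i)) \<longlonglongrightarrow> \<gamma> ^ p * exp (\<integral>\<zeta>. levy_poly p \<zeta> \<partial>\<sigma>)"
    by (intro tendsto_mult tendsto_power drift_tendsto)
  moreover have "moment (conv_row circle_conv (lam n) (M n) (k n)) p = drift n ^ p * (\<Prod>i\<in>{1..k n}. 1 + ?y n i)" for n
  proof -
    have "moment (conv_row circle_conv (lam n) (M n) (k n)) p = lam n ^ p * (\<Prod>i\<in>{1..k n}. moment (M n i) p)"
      by (rule conjunct2[OF circle_conv_row]) (use lam M in auto)
    also have "(\<Prod>i\<in>{1..k n}. moment (M n i) p) = (\<Prod>i\<in>{1..k n}. sgn (moment (M n i) 1) ^ p * (1 + ?y n i))"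
      by (intro prod.cong refl) (metis moment_eq_centre M nz y)
    finally show ?thesis by (simp add: drift_def power_mult_distrib prod.distrib prod_power_distrib)
  qed
  ultimately show ?thesis by simp
qed

end

theorem theorem4p1:
  fixes k :: "nat \<Rightarrow> nat"
    and \<mu> :: "nat \<Rightarrow> nat \<Rightarrow> complex measure"
    and lam :: "nat \<Rightarrow> complex"
    and \<gamma> :: complex
    and \<sigma> :: "complex measure"
  assumes "\<And>n. n \<ge> 1 \<Longrightarrow> k n \<ge> 1"
    and "\<And>n i. n \<ge> 1 \<Longrightarrow> 1 \<le> i \<Longrightarrow> i \<le> k n \<Longrightarrow> \<mu> n i \<in> circle_prob_nz"
    and "infinitesimal_array k \<mu>"
    and "\<And>n. n \<ge> 1 \<Longrightarrow> lam n \<in> sphere 0 1"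
    and "\<gamma> \<in> sphere 0 1"
    and "finite_measure \<sigma>"
    and "sets \<sigma> = sets circle_borel"
    and "circle_weak_conv (\<lambda>n. conv_row bool_mult_conv (lam n) (\<mu> n) (k n)) (bool_infdiv \<gamma> \<sigma>)"
  shows "\<exists>\<nu>\<in>circle_prob.
           circle_weak_conv (\<lambda>n. conv_row circle_conv (lam n) (\<mu> n) (k n)) \<nu> \<and>
           (\<forall>p::int. fourier_coeff \<nu> p = \<gamma> powi p * exp (\<integral>\<zeta>. levy_kernel p \<zeta> \<partial>\<sigma>))"
proof -
  \<comment> \<open>nothing is known about row \<open>0\<close>, so the numbering is shifted to make row \<open>1\<close> the first\<close>
  define k' where "k' n = k (Suc n)" for n
  define M where "M n = \<mu> (Suc n)" for n
  define lam' where "lam' n = lam (Suc n)" for n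
  define \<delta> where "\<delta> n = (MAX i\<in>{1..k' n}. norm (1 - moment (M n i) 1))" for n
  have k': "k' n \<ge> 1" for n using assms(1) by (simp add: k'_def)
  have M: "M n i \<in> circle_prob" and nz: "moment (M n i) 1 \<noteq> 0" if "i \<in> {1..k' n}" for n i
    using assms(2)[of "Suc n" i] that by (auto simp: M_def k'_def circle_prob_nz_def moment_def)
  have lam': "norm (lam' n) = 1" for n using assms(4)[of "Suc n"] by (simp add: lam'_def)
  have \<gamma>: "norm \<gamma> = 1" using assms(5) by simp
  have \<sigma>: "circle_measure \<sigma>" using assms(6,7) by (simp add: circle_measure_def)
  have "infinitesimal_array k' M"
    unfolding infinitesimal_array_def k'_def M_def
  proof (intro allI impI)
    fix \<epsilon> :: real assume "\<epsilon> > 0"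
    with assms(3) have "(\<lambda>n. MAX i\<in>{1..k n}. measure (\<mu> n i) {\<zeta> \<in> sphere 0 1. cmod (\<zeta> - 1) \<ge> \<epsilon>}) \<longlonglongrightarrow> 0"
      unfolding infinitesimal_array_def by blast
    then show "(\<lambda>n. MAX i\<in>{1..k (Suc n)}. measure (\<mu> (Suc n) i) {\<zeta> \<in> sphere 0 1. cmod (\<zeta> - 1) \<ge> \<epsilon>}) \<longlonglongrightarrow> 0"
      by (rule LIMSEQ_Suc)
  qed
  then have \<delta>: "\<delta> \<longlonglongrightarrow> 0"
    unfolding \<delta>_def by (rule infinitesimal_imp_moments_tendsto_1[OF _ k' M])
  have close: "norm (1 - moment (M n i) 1) \<le> \<delta> n" if "i \<in> {1..k' n}" for n i
    unfolding \<delta>_def using that by (intro Max_ge) auto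
  have \<delta>0: "0 \<le> \<delta> n" for n
    by (rule order_trans[OF norm_ge_zero close[of 1 n]]) (use k' in simp)
  have weak: "circle_weak_conv (\<lambda>n. conv_row bool_mult_conv (lam' n) (M n) (k' n)) (bool_infdiv \<gamma> \<sigma>)"
    unfolding circle_weak_conv_def k'_def M_def lam'_def
    by (intro allI impI, rule LIMSEQ_Suc) (rule assms(8)[unfolded circle_weak_conv_def, rule_format])
  have lim: "(\<lambda>n. moment (conv_row circle_conv (lam' n) (M n) (k' n)) p) \<longlonglongrightarrow> \<gamma> ^ p * exp (\<integral>\<zeta>. levy_poly p \<zeta> \<partial>\<sigma>)" for p
    by (rule moment_circle_conv_row_tendsto[OF M nz lam' \<gamma> \<sigma> \<delta> \<delta>0 close weak])
  have row: "conv_row circle_conv (lam' n) (M n) (k' n) \<in> circle_prob" for n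
    by (rule conjunct1[OF circle_conv_row]) (use lam' M in auto)
  obtain \<nu> where \<nu>: "\<nu> \<in> circle_prob" "\<And>p. moment \<nu> p = \<gamma> ^ p * exp (\<integral>\<zeta>. levy_poly p \<zeta> \<partial>\<sigma>)"
      and w: "circle_weak_conv (\<lambda>n. conv_row circle_conv (lam' n) (M n) (k' n)) \<nu>"
    using circle_prob_moment_limit[OF row lim] by blast
  have conv: "circle_weak_conv (\<lambda>n. conv_row circle_conv (lam n) (\<mu> n) (k n)) \<nu>"
    unfolding circle_weak_conv_def
    by (intro allI impI, rule LIMSEQ_imp_Suc)
       (rule w[unfolded circle_weak_conv_def k'_def M_def lam'_def, rule_format])
  have nonneg: "fourier_coeff \<nu> (int p) = \<gamma> powi int p * exp (\<integral>\<zeta>. levy_kernel (int p) \<zeta> \<partial>\<sigma>)" for p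
  proof -
    have "(\<integral>\<zeta>. levy_kernel (int p) \<zeta> \<partial>\<sigma>) = (\<integral>\<zeta>. levy_poly p \<zeta> \<partial>\<sigma>)"
      by (rule circle_integral_cong[OF \<sigma>]) (rule levy_kernel_eq_levy_poly)
    then show ?thesis by (simp add: fourier_coeff_of_nat \<nu>(2))
  qed
  moreover have "fourier_coeff \<nu> (- int p) = \<gamma> powi (- int p) * exp (\<integral>\<zeta>. levy_kernel (- int p) \<zeta> \<partial>\<sigma>)" for p
  proof -
    have "(\<integral>\<zeta>. levy_kernel (- int p) \<zeta> \<partial>\<sigma>) = cnj (\<integral>\<zeta>. levy_kernel (int p) \<zeta> \<partial>\<sigma>)"
      unfolding Bochner_Integration.integral_cnj[symmetric]
      by (rule circle_integral_cong[OF \<sigma>]) (rule levy_kernel_minus)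
    then show ?thesis
      unfolding fourier_coeff_minus[OF circle_prob_imp_circle_measure[OF \<nu>(1)]] nonneg powi_minus_circle[OF \<gamma>]
      by (simp only: complex_cnj_mult exp_cnj)
  qed
  ultimately have "fourier_coeff \<nu> p = \<gamma> powi p * exp (\<integral>\<zeta>. levy_kernel p \<zeta> \<partial>\<sigma>)" for p
    by (cases p rule: int_cases2) simp_all
  with conv show ?thesis using \<nu>(1) by blast
qed

end
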